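(* Let $\ell\ge2$ and let $\mathcal R$ be a merging $\ell$-vertex rule, with associated random graph sequences $(G(m))_{m\ge0}=(G_n^{\mathcal R}(m))_{m\ge0}$ on $[n]$. Let $h_m(n)$ be any function with $h_m(n)=o(n)$, and let $0\le a<b$ be constants. Then the probability that there exist $m_1,m_2$ with $L_1(G(m_1))\le an$, $L_1(G(m_2))\ge bn$ and $m_2\le m_1+h_m(n)$ tends to $0$ as $n\to\infty$.
   Context: $\ell$-vertex rule: fix an integer $\ell\ge2$. For each $n$, let $(\underline v_1,\underline v_2,\dots)$ be an i.i.d. sequence, where each $\underline v_m=(v_{m,1},\dots,v_{m,\ell})$ consists of $\ell$ vertices of $[n]$ chosen independently and uniformly at random. There is a filtration $\mathcal F_0\subseteq\mathcal F_1\subseteq\cdots$ such that $\underline v_m$ is $\mathcal F_m$-measurable and independent of $\mathcal F_{m-1}$. An $\ell$-vertex rule is a random sequence of graphs $(G(m))_{m\ge0}$ on $[n]$ such that: (i) $G(0)$ is empty; (ii) for $m\ge1$, $G(m)=G(m-1)\cup E_m$ where $E_m$ is a (possibly empty) $\mathcal F_m$-measurable set of edges each joining two vertices of $\underline v_m$; (iii) if the $\ell$ vertices of $\underline v_m$ lie in $\ell$ distinct components of $G(m-1)$, then $E_m\ne\varnothing$. Merging: for every $\varepsilon>0$, $n$, $m\ge1$, whenever $C,C'$ are distinct components of $G(m-1)$ with $|C|,|C'|\ge\varepsilon n$, conditional on $\mathcal F_{m-1}$ the probability that $C$ and $C'$ lie in the same component of $G(m)$ is at least $\varepsilon^\ell$.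 $L_1(G)$ is the number of vertices in a largest component of $G$. *)

theory Defs
  imports "HOL-Probability.Probability" "HOL-Library.Landau_Symbols"
begin

text \<open>Graphs on the vertex set [n] = {0..<n} are given by their edge sets, an edge being
a two-element set of vertices.\<close>

definition conn :: "nat set set \<Rightarrow> nat \<Rightarrow> nat \<Rightarrow> bool" where
  "conn E x y \<longleftrightarrow> (x, y) \<in> {(a, b). {a, b} \<in> E}\<^sup>*"

definition comp :: "nat \<Rightarrow> nat set set \<Rightarrow> nat \<Rightarrow> nat set" where
  "comp n E x = {y. y < n \<and> conn E x y}"

definition L1 :: "nat \<Rightarrow> nat set set \<Rightarrow> nat" where
  "L1 n E = Max (insert 0 ((\<lambda>x. card (comp n E x)) ` {..<n}))"

fun rgraph :: "(nat \<Rightarrow> 'a \<Rightarrow> nat set set) \<Rightarrow> nat \<Rightarrow> 'a \<Rightarrow> nat set set" where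
  "rgraph E 0 \<omega> = {}"
| "rgraph E (Suc m) \<omega> = rgraph E m \<omega> \<union> E (Suc m) \<omega>"

text \<open>An l-vertex rule on [n]: probability space M, filtration F, vertex tuples v
(v m \<omega> i for i < l is the i-th vertex of the m-th tuple, m \<ge> 1) and edge sets E (m \<ge> 1).\<close>
definition l_vertex_rule ::
  "nat \<Rightarrow> nat \<Rightarrow> 'a measure \<Rightarrow> (nat \<Rightarrow> 'a measure) \<Rightarrow> (nat \<Rightarrow> 'a \<Rightarrow> nat \<Rightarrow> nat)
     \<Rightarrow> (nat \<Rightarrow> 'a \<Rightarrow> nat set set) \<Rightarrow> bool" where
  "l_vertex_rule l n M F v E \<longleftrightarrow>
     prob_space M \<and>
     filtration (space M) F \<and>
     (\<forall>m. subalgebra M (F m)) \<and>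
     \<comment> \<open>the tuples consist of vertices of [n] and are adapted\<close>
     (\<forall>m \<ge> 1. \<forall>\<omega> \<in> space M. \<forall>i < l. v m \<omega> i < n) \<and>
     (\<forall>m \<ge> 1. \<forall>i < l. (\<lambda>\<omega>. v m \<omega> i) \<in> measurable (F m) (count_space UNIV)) \<and>
     \<comment> \<open>v_m is uniform on [n]^l and independent of F_{m-1}\<close>
     (\<forall>m. \<forall>A \<in> sets (F m). \<forall>t. (\<forall>i < l. t i < n) \<longrightarrow>
        measure M (A \<inter> {\<omega> \<in> space M. \<forall>i < l. v (Suc m) \<omega> i = t i})
          = measure M A / real n ^ l) \<and>
     \<comment> \<open>(ii): E_m is F_m-measurable, each edge joins two (distinct) vertices of v_m\<close>
     (\<forall>m \<ge> 1. E m \<in> measurable (F m) (count_space UNIV)) \<and>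
     (\<forall>m \<ge> 1. \<forall>\<omega> \<in> space M. \<forall>e \<in> E m \<omega>.
        \<exists>i < l. \<exists>j < l. v m \<omega> i \<noteq> v m \<omega> j \<and> e = {v m \<omega> i, v m \<omega> j}) \<and>
     \<comment> \<open>(iii): if the l vertices lie in l distinct components of G(m-1), E_m is nonempty\<close>
     (\<forall>m. \<forall>\<omega> \<in> space M.
        (\<forall>i < l. \<forall>j < l. i \<noteq> j \<longrightarrow> \<not> conn (rgraph E m \<omega>) (v (Suc m) \<omega> i) (v (Suc m) \<omega> j))
        \<longrightarrow> E (Suc m) \<omega> \<noteq> {})"

definition merging ::
  "nat \<Rightarrow> nat \<Rightarrow> 'a measure \<Rightarrow> (nat \<Rightarrow> 'a measure) \<Rightarrow> (nat \<Rightarrow> 'a \<Rightarrow> nat set set) \<Rightarrow> bool" where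
  "merging l n M F E \<longleftrightarrow>
     (\<forall>\<epsilon>::real. \<epsilon> > 0 \<longrightarrow> (\<forall>m x y.
        AE \<omega> in M.
          (x < n \<and> y < n \<and> \<not> conn (rgraph E m \<omega>) x y \<and>
           real (card (comp n (rgraph E m \<omega>) x)) \<ge> \<epsilon> * real n \<and>
           real (card (comp n (rgraph E m \<omega>) y)) \<ge> \<epsilon> * real n)
          \<longrightarrow> real_cond_exp M (F m)
                (indicator {\<omega>' \<in> space M. conn (rgraph E (Suc m) \<omega>') x y}) \<omega> \<ge> \<epsilon> ^ l))"

end

theory Submission
  imports Defs "HOL-Real_Asymp.Real_Asymp"
begin

text \<open>
  Write \<open>N k m\<close> for the number of vertices of \<open>G m\<close> in components of size at least \<open>k\<close>.
  One step changes \<open>N k\<close> by at most \<open>l * k\<close>, so a jump of \<open>L1\<close> from \<open>a n\<close> to \<open>b n\<close> within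
  \<open>o(n)\<close> steps after time \<open>m1\<close> forces \<open>N k m1 \<ge> (b - o(1)) n\<close> for every constant \<open>k\<close>.

  Powder keg: if at time \<open>s\<close> a set \<open>W\<close> of vertices lies in components of size at least \<open>k\<close>, then \<open>W\<close>
  meets at most \<open>n / k\<close> components. As long as \<open>\<eta> n\<close> vertices of \<open>W\<close> are not in linear-sized
  components, each step merges two components meeting \<open>W\<close> with probability bounded below. Hence after
  \<open>C n / k\<close> steps, \<open>C = C(\<eta>)\<close>, all but \<open>\<eta> n\<close> vertices of \<open>W\<close> are in linear-sized components, and by
  the merging property these coalesce, so \<open>L1 \<ge> |W| - \<eta> n\<close>.

  Survival: in \<open>\<delta> n\<close> steps a component of size at most \<open>C / \<delta>\<close> is untouched with probability bounded
  below. By pigeonhole along the scales \<open>k\<^sub>j = A ^ (j + 1)\<close> some \<open>j\<close> has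
  \<open>N k\<^sub>j m1 - N k\<^sub>j\<^sub>+\<^sub>1 m1\<close> tiny. At time \<open>s = m1 - \<Theta>(n / k\<^sub>j)\<close> there were then already few vertices
  in components of size between \<open>k\<^sub>j\<close> and \<open>k\<^sub>j\<^sub>+\<^sub>1\<close>, so almost \<open>b n\<close> vertices lie in components of size
  at least \<open>k\<^sub>j\<^sub>+\<^sub>1\<close>; the powder keg explodes before time \<open>m1\<close>, contradicting \<open>L1 \<le> a n\<close>.
\<close>

section \<open>Components\<close>

lemma conn_refl [simp]: "conn G x x"
  by (simp add: conn_def)

lemma conn_edge: "{x, y} \<in> G \<Longrightarrow> conn G x y"
  by (auto simp: conn_def)

lemma conn_trans: "conn G x y \<Longrightarrow> conn G y z \<Longrightarrow> conn G x z"
  unfolding conn_def by (rule rtrancl_trans)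

lemma conn_sym: "conn G x y \<Longrightarrow> conn G y x"
proof -
  have "sym ({(a, b). {a, b} \<in> G}\<^sup>*)"
    by (rule sym_rtrancl) (auto simp: sym_def insert_commute)
  then show "conn G x y \<Longrightarrow> conn G y x"
    unfolding conn_def by (rule symD)
qed

lemma conn_mono: "conn G x y \<Longrightarrow> G \<subseteq> G' \<Longrightarrow> conn G' x y"
  unfolding conn_def by (erule rtrancl_mono[THEN subsetD, rotated]) auto

lemma finite_comp [simp]: "finite (comp n G x)"
  by (simp add: comp_def)

lemma comp_subset: "comp n G x \<subseteq> {..<n}"
  by (auto simp: comp_def)

lemma self_in_comp: "x < n \<Longrightarrow> x \<in> comp n G x"
  by (simp add: comp_def)

lemma comp_mono: "G \<subseteq> G' \<Longrightarrow> comp n G x \<subseteq> comp n G' x"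
  by (auto simp: comp_def intro: conn_mono)

lemma comp_eqI: "conn G x y \<Longrightarrow> comp n G x = comp n G y"
  unfolding comp_def by (metis conn_sym conn_trans)

lemma comp_eq_iff: "x < n \<Longrightarrow> comp n G y = comp n G x \<longleftrightarrow> conn G y x"
  using self_in_comp[of x n G] comp_eqI[of G y x n] unfolding comp_def by blast

lemma comp_disjoint: "\<not> conn G x y \<Longrightarrow> comp n G x \<inter> comp n G y = {}"
  unfolding comp_def using conn_sym conn_trans by blast

lemma card_comp_le_L1: "x < n \<Longrightarrow> card (comp n G x) \<le> L1 n G"
  unfolding L1_def by (intro Max_ge) auto

lemma L1_attained:
  assumes "n \<ge> 1"
  shows "\<exists>x<n. card (comp n G x) = L1 n G"
proof -
  let ?S = "(\<lambda>x. card (comp n G x)) ` {..<n}"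
  have "?S \<noteq> {}" using assms by (auto simp: lessThan_empty_iff)
  then have "L1 n G = Max ?S"
    unfolding L1_def by (subst Max_insert) auto
  moreover have "Max ?S \<in> ?S"
    using \<open>?S \<noteq> {}\<close> by (intro Max_in) auto
  ultimately show ?thesis by auto
qed

lemma L1_mono:
  assumes "G \<subseteq> G'"
  shows "L1 n G \<le> L1 n G'"
proof (cases "n \<ge> 1")
  case True
  then obtain x where "x < n" "card (comp n G x) = L1 n G"
    using L1_attained by blast
  then show ?thesis
    using card_mono[OF finite_comp comp_mono[OF assms, of n x]] card_comp_le_L1[of x n G']
    by linarith
qed (simp add: L1_def)

section \<open>Vertices in components above a size threshold\<close>

definition large :: "nat \<Rightarrow> nat set set \<Rightarrow> real \<Rightarrow> nat set" where
  "large n G r = {x. x < n \<and> r \<le> real (card (comp n G x))}"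

lemma large_subset: "large n G r \<subseteq> {..<n}"
  by (auto simp: large_def)

lemma finite_large [simp]: "finite (large n G r)"
  by (simp add: large_def)

lemma card_large_le: "card (large n G r) \<le> n"
  using card_mono[OF _ large_subset[of n G r]] by simp

lemma large_mono: "G \<subseteq> G' \<Longrightarrow> large n G r \<subseteq> large n G' r"
  unfolding large_def
  using card_mono[OF finite_comp comp_mono, of G G' n] by (auto intro: order_trans)

lemma large_antimono: "r \<le> r' \<Longrightarrow> large n G r' \<subseteq> large n G r"
  by (auto simp: large_def)

lemma large_1: "large n G 1 = {..<n}"
proof -
  have "card (comp n G x) > 0" if "x < n" for x
    using self_in_comp[OF that] by (subst card_gt_0_iff) auto
  then show ?thesis by (force simp: large_def)
qed

lemma conn_empty: "conn {} x y \<longleftrightarrow> x = y"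
  by (simp add: conn_def)

lemma large_empty: "r > 1 \<Longrightarrow> large n {} r = {}"
proof -
  have "comp n {} x \<subseteq> {x}" for x by (auto simp: comp_def conn_empty)
  then have "card (comp n {} x) \<le> 1" for x
    using card_mono[of "{x}" "comp n {} x"] by simp
  then have *: "real (card (comp n {} x)) \<le> 1" for x by (metis of_nat_1 of_nat_le_iff)
  then show "r > 1 \<Longrightarrow> large n {} r = {}"
    using le_less_trans[OF *] by (auto simp: large_def not_le simp del: One_nat_def)
qed

lemma L1_le_card_large:
  assumes "n \<ge> 1" and "r \<le> real (L1 n G)"
  shows "L1 n G \<le> card (large n G r)"
proof -
  obtain x where x: "x < n" "card (comp n G x) = L1 n G"
    using L1_attained[OF assms(1)] by blast
  have "comp n G x \<subseteq> large n G r"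
  proof
    fix y assume "y \<in> comp n G x"
    then show "y \<in> large n G r"
      using comp_eqI[of G x y n] x assms(2) by (auto simp: large_def comp_def)
  qed
  from card_mono[OF finite_large this] x show ?thesis by simp
qed

lemma card_large_le_L1:
  assumes "\<And>x y. x \<in> large n G r \<Longrightarrow> y \<in> large n G r \<Longrightarrow> conn G' x y"
  shows "card (large n G r) \<le> L1 n G'"
proof (cases "large n G r = {}")
  case False
  then obtain x where x: "x \<in> large n G r" by blast
  then have "large n G r \<subseteq> comp n G' x"
    using assms large_subset[of n G r] by (auto simp: comp_def)
  from card_mono[OF finite_comp this] card_comp_le_L1[of x n G'] x show ?thesis
    by (auto simp: large_def)
qed simp

text \<open>A path leaving the old component would use an edge of \<open>H\<close>. The first such
  edge starts at a vertex of \<open>V\<close> that \<open>G\<close> already reaches, which the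
  disjointness excludes.\<close>

lemma comp_Un_untouched:
  assumes "\<And>e. e \<in> H \<Longrightarrow> e \<subseteq> V" and "comp n G x \<inter> V = {}" and "V \<subseteq> {..<n}"
  shows "comp n (G \<union> H) x = comp n G x"
proof -
  have "conn G x y" if "conn (G \<union> H) x y" for y
    using that unfolding conn_def
  proof (induction rule: rtrancl_induct)
    case (step y z)
    then have y: "conn G x y" by (simp add: conn_def)
    show ?case
    proof (cases "{y, z} \<in> G")
      case True
      then show ?thesis using step by (auto intro: rtrancl_into_rtrancl)
    next
      case False
      then have "y \<in> V" using step assms(1)[of "{y,z}"] by auto
      then have "y \<in> comp n G x \<inter> V" using y assms(3) by (auto simp: comp_def)
      then show ?thesis using assms(2) by auto
    qed
  qed auto
  then have "comp n (G \<union> H) x \<subseteq> comp n G x"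
    by (auto simp: comp_def)
  then show ?thesis using comp_mono[of G "G \<union> H" n x] by auto
qed

text \<open>A vertex enters the large set only if its old component, of size below \<open>r\<close>,
  contains a vertex of \<open>V\<close>. There are at most \<open>l\<close> such components, each
  with at most \<open>r\<close> vertices.\<close>

lemma card_large_Un:
  assumes "\<And>e. e \<in> H \<Longrightarrow> e \<subseteq> V" and "V \<subseteq> {..<n}" and "card V \<le> l" and "r \<ge> 0"
  shows "real (card (large n (G \<union> H) r)) \<le> real (card (large n G r)) + real l * r"
proof -
  have fV: "finite V" using assms(2) finite_subset by blast
  define V' where "V' = {v \<in> V. real (card (comp n G v)) < r}"
  have V': "finite V'" "card V' \<le> l"
    using fV card_mono[of V V'] assms(3) by (auto simp: V'_def)
  have "large n (G \<union> H) r \<subseteq> large n G r \<union> (\<Union>v\<in>V'. comp n G v)"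
  proof
    fix x assume x: "x \<in> large n (G \<union> H) r"
    show "x \<in> large n G r \<union> (\<Union>v\<in>V'. comp n G v)"
    proof (cases "x \<in> large n G r")
      case False
      then have lt: "real (card (comp n G x)) < r" using x by (auto simp: large_def)
      then have "comp n (G \<union> H) x \<noteq> comp n G x" using x by (auto simp: large_def)
      then obtain v where v: "v \<in> V" "v \<in> comp n G x"
        using comp_Un_untouched[of H V n G x] assms by blast
      then have c: "conn G x v" by (auto simp: comp_def)
      with v lt have "v \<in> V'" using comp_eqI[OF c, of n] by (auto simp: V'_def)
      moreover have "x \<in> comp n G v"
        using conn_sym[OF c] x by (auto simp: comp_def large_def)
      ultimately show ?thesis by blast
    qed simp
  qed
  then have "card (large n (G \<union> H) r) \<le> card (large n G r \<union> (\<Union>v\<in>V'. comp n G v))"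
    using V' by (intro card_mono) auto
  also have "\<dots> \<le> card (large n G r) + card (\<Union>v\<in>V'. comp n G v)"
    by (rule card_Un_le)
  finally have "real (card (large n (G \<union> H) r)) \<le>
      real (card (large n G r)) + real (card (\<Union>v\<in>V'. comp n G v))"
    by linarith
  moreover have "real (card (\<Union>v\<in>V'. comp n G v)) \<le> (\<Sum>v\<in>V'. real (card (comp n G v)))"
    using card_UN_le[OF V'(1), of "comp n G"] by (metis of_nat_le_iff of_nat_sum)
  moreover have "(\<Sum>v\<in>V'. real (card (comp n G v))) \<le> (\<Sum>v\<in>V'. r)"
    by (rule sum_mono) (auto simp: V'_def)
  moreover have "(\<Sum>v\<in>V'. r) \<le> real l * r"
    using V'(2) assms(4) by (auto intro: mult_right_mono)
  ultimately show ?thesis by linarith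
qed

section \<open>Number of components meeting a vertex set\<close>

lemma comps_coarsen:
  assumes "G \<subseteq> G'" and "W \<subseteq> {..<n}"
  shows "comp n G' ` W = (\<lambda>C. \<Union>z\<in>C. comp n G' z) ` (comp n G ` W)"
proof -
  have "(\<Union>z\<in>comp n G x. comp n G' z) = comp n G' x" if "x < n" for x
  proof -
    have "comp n G' z = comp n G' x" if "z \<in> comp n G x" for z
      using that conn_mono[OF _ assms(1)] by (intro comp_eqI) (auto simp: comp_def intro: conn_sym)
    then have "(\<Union>z\<in>comp n G x. comp n G' z) = (\<Union>z\<in>comp n G x. comp n G' x)"
      by (rule SUP_cong[OF refl])
    then show ?thesis using self_in_comp[OF that, of G] by auto
  qed
  then show ?thesis using assms(2) unfolding image_image by (intro image_cong) auto
qed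

lemma card_comps_mono:
  assumes "G \<subseteq> G'" and "W \<subseteq> {..<n}"
  shows "card (comp n G' ` W) \<le> card (comp n G ` W)"
  unfolding comps_coarsen[OF assms] using finite_subset[OF assms(2)] by (intro card_image_le) auto

text \<open>Adding edges maps the old components meeting \<open>W\<close> onto the new ones. Equal
  counts would make this surjection injective, yet it identifies the distinct components of
  \<open>x\<close> and \<open>y\<close>.\<close>

lemma card_comps_less:
  assumes "G \<subseteq> G'" and "W \<subseteq> {..<n}" and "x \<in> W" "y \<in> W" "\<not> conn G x y" "conn G' x y"
  shows "card (comp n G' ` W) < card (comp n G ` W)"
proof (rule ccontr)
  assume "\<not> ?thesis"
  then have eq: "card (comp n G' ` W) = card (comp n G ` W)"
    using card_comps_mono[OF assms(1,2)] by simp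
  let ?f = "\<lambda>C. \<Union>z\<in>C. comp n G' z"
  have fin: "finite W" using assms(2) finite_subset by blast
  have "inj_on ?f (comp n G ` W)"
  proof (rule eq_card_imp_inj_on)
    show "finite (comp n G ` W)" using fin by simp
    show "card (?f ` comp n G ` W) = card (comp n G ` W)"
      unfolding comps_coarsen[OF assms(1,2), symmetric] by (rule eq)
  qed
  moreover have "?f (comp n G x) = ?f (comp n G y)"
  proof -
    have "?f (comp n G z) = comp n G' z" if "z \<in> W" for z
      using comps_coarsen[OF assms(1), of "{z}" n] that assms(2) by auto
    then show ?thesis using assms(3,4) comp_eqI[OF assms(6)] by metis
  qed
  ultimately have "comp n G x = comp n G y"
    using assms(3,4) unfolding inj_on_def by blast
  then show False using assms(2,4,5) comp_eq_iff[of y n G x] by auto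
qed

text \<open>The components counted are disjoint and have at least \<open>r\<close> vertices each.
  This caps the exponent of the powder-keg potential at \<open>real n / r\<close>.\<close>

lemma card_comps_large:
  "r * real (card (comp n G ` large n G r)) \<le> real n"
proof -
  let ?K = "comp n G ` large n G r"
  have "card (\<Union>?K) = (\<Sum>C\<in>?K. card C)"
  proof (rule card_Union_disjoint)
    show "pairwise disjnt ?K"
      unfolding pairwise_def disjnt_def using comp_disjoint comp_eqI by blast
  qed auto
  moreover have "card (\<Union>?K) \<le> card {..<n}"
    using comp_subset by (intro card_mono) auto
  ultimately have "(\<Sum>C\<in>?K. real (card C)) \<le> real n"
    by (metis card_lessThan of_nat_le_iff of_nat_sum)
  moreover have "(\<Sum>C\<in>?K. r) \<le> (\<Sum>C\<in>?K. real (card C))"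
    by (rule sum_mono) (auto simp: large_def)
  ultimately show ?thesis by (simp add: mult.commute)
qed

section \<open>Tuples with entries in distinct components\<close>

definition spread :: "nat set set \<Rightarrow> nat set \<Rightarrow> nat \<Rightarrow> (nat \<Rightarrow> nat) set" where
  "spread G R j = {t \<in> {..<j} \<rightarrow>\<^sub>E R. \<forall>i<j. \<forall>i'<j. i \<noteq> i' \<longrightarrow> \<not> conn G (t i) (t i')}"

text \<open>Entries are chosen one after another: the earlier ones block fewer than \<open>l\<close>
  components of at most \<open>d\<close> vertices each, so at least \<open>r - real l * d\<close>
  choices in \<open>R\<close> remain. For \<open>j = l\<close> these are tuples that force the rule
  to add an edge.\<close>

lemma card_spread:
  assumes R: "R \<subseteq> {..<n}" "r \<le> real (card R)"
    and d: "\<And>x. x \<in> R \<Longrightarrow> real (card (comp n G x)) \<le> d" "0 \<le> d" "real l * d \<le> r"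
  shows "j \<le> l \<Longrightarrow> (r - real l * d) ^ j \<le> real (card (spread G R j))"
proof (induction j)
  case 0
  have "spread G R 0 = {\<lambda>_. undefined}" by (auto simp: spread_def)
  then show ?case by simp
next
  case (Suc j)
  have finR: "finite R" using R finite_subset by blast
  have fin: "finite (spread G R i)" for i
    unfolding spread_def using finR by (auto intro!: finite_PiE)
  define X where "X t = R - (\<Union>i<j. comp n G (t i))" for t :: "nat \<Rightarrow> nat"
  have finX: "finite (X t)" for t using finR by (simp add: X_def)
  have cardX: "r - real l * d \<le> real (card (X t))" if t: "t \<in> spread G R j" for t
  proof -
    have tR: "t i \<in> R" if "i < j" for i using t that by (auto simp: spread_def)
    have "card R - card (\<Union>i<j. comp n G (t i)) \<le> card (X t)"
      unfolding X_def by (rule diff_card_le_card_Diff) auto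
    then have "real (card R) \<le> real (card (X t)) + real (card (\<Union>i<j. comp n G (t i)))"
      by linarith
    moreover have "real (card (\<Union>i<j. comp n G (t i))) \<le> (\<Sum>i<j. real (card (comp n G (t i))))"
      using card_UN_le[of "{..<j}" "\<lambda>i. comp n G (t i)"]
      by (metis finite_lessThan of_nat_le_iff of_nat_sum)
    moreover have "\<dots> \<le> (\<Sum>i<j. d)"
      using d(1) tR by (intro sum_mono) auto
    moreover have "\<dots> \<le> real l * d"
      using Suc.prems d(2) by (auto intro!: mult_right_mono)
    ultimately show ?thesis using R(2) by linarith
  qed
  let ?ext = "\<lambda>(t, y). t(j := y)"
  \<comment> \<open>The extensional function \<open>t\<close> is \<open>undefined\<close> at
    \<open>j\<close>, hence it is recovered from \<open>t(j := y)\<close>.\<close>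
  have inj: "inj_on ?ext (Sigma (spread G R j) X)"
  proof (rule inj_onI, clarify)
    fix t y t' y'
    assume a: "t \<in> spread G R j" "t' \<in> spread G R j" and eq: "t(j := y) = t'(j := y')"
    have "t = t'"
    proof
      fix i
      show "t i = t' i"
        using fun_cong[OF eq, of i] PiE_arb[of t "{..<j}" "\<lambda>_. R" i] PiE_arb[of t' "{..<j}" "\<lambda>_. R" i] a
        by (cases "i = j") (auto simp: spread_def)
    qed
    then show "t = t' \<and> y = y'" using fun_cong[OF eq, of j] by simp
  qed
  have sub: "?ext ` Sigma (spread G R j) X \<subseteq> spread G R (Suc j)"
  proof clarify
    fix t y assume t: "t \<in> spread G R j" and y: "y \<in> X t"
    have "y < n" using y R by (auto simp: X_def)
    then have n1: "\<not> conn G (t i) y" if "i < j" for i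
      using y that by (auto simp: X_def comp_def)
    then have n2: "\<not> conn G y (t i)" if "i < j" for i
      using that conn_sym by blast
    have "t(j := y) \<in> {..<Suc j} \<rightarrow>\<^sub>E R"
      using t y by (auto simp: spread_def X_def PiE_def extensional_def Pi_def less_Suc_eq)
    then show "t(j := y) \<in> spread G R (Suc j)"
      using n1 n2 t by (auto simp: spread_def less_Suc_eq)
  qed
  have "(r - real l * d) ^ Suc j \<le> (r - real l * d) * real (card (spread G R j))"
    using Suc d(3) by (auto intro!: mult_left_mono)
  also have "\<dots> = (\<Sum>t\<in>spread G R j. r - real l * d)" by simp
  also have "\<dots> \<le> (\<Sum>t\<in>spread G R j. real (card (X t)))"
    using cardX by (intro sum_mono)
  also have "\<dots> = real (card (Sigma (spread G R j) X))"
    using fin finX by simp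
  also have "\<dots> = real (card (?ext ` Sigma (spread G R j) X))"
    using card_image[OF inj] by simp
  also have "\<dots> \<le> real (card (spread G R (Suc j)))"
    using card_mono[OF fin sub] by simp
  finally show ?case .
qed

section \<open>Asymptotics of the error terms\<close>

text \<open>Here \<open>ln (1 - x) \<ge> - x - 2 * x\<^sup>2\<close>, and the quadratic term is at
  most \<open>x\<close> on this range. It serves to bound survival probabilities below by a
  constant.\<close>

lemma exp_le_one_minus:
  fixes x :: real
  assumes "0 \<le> x" "x \<le> 1 / 2"
  shows "exp (- 2 * x) \<le> 1 - x"
proof -
  have "2 * x\<^sup>2 \<le> x" using mult_left_mono[OF assms(2,1)] by (simp add: power2_eq_square)
  then have "- 2 * x \<le> ln (1 - x)"
    using ln_one_minus_pos_lower_bound[OF assms] by linarith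
  then have "exp (- 2 * x) \<le> exp (ln (1 - x))" by simp
  then show ?thesis using assms by simp
qed

text \<open>Failure probability of two phases of \<open>T\<close> steps: either the powder keg
  fails, or one of the \<open>real n ^ 2\<close> vertex pairs in linear-sized components stays
  unconnected.\<close>

definition tail :: "nat \<Rightarrow> real \<Rightarrow> nat \<Rightarrow> real \<Rightarrow> nat \<Rightarrow> real" where
  "tail l \<eta> n r T = 2 powr (real n / r) * (1 - (\<eta> / 2) ^ l / 2) ^ T + real n ^ 2 * (1 - (\<eta> / (2 * real l)) ^ l) ^ T"

lemma one_minus_power_le_exp:
  fixes x d :: real
  assumes "0 \<le> d" "d \<le> 1" "x \<le> real T"
  shows "(1 - d) ^ T \<le> exp (- d * x)"
proof -
  have "(1 - d) ^ T \<le> exp (- d) ^ T" using assms exp_ge_add_one_self[of "- d"] by (intro power_mono) auto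
  also have "\<dots> = exp (- d * real T)" by (simp add: mult.commute flip: exp_of_nat_mult)
  also have "\<dots> \<le> exp (- d * x)" using assms by (simp add: mult_left_mono)
  finally show ?thesis .
qed

text \<open>The condition on \<open>1 / r\<close> says that the decay over \<open>x * real n\<close>
  steps beats the initial size \<open>2 powr (real n / r) \<le> exp (real n / r)\<close> of the
  potential. In the other summand exponential decay beats a quadratic factor. The \<open>- 1\<close>
  leaves room for rounding.\<close>

lemma tail_tendsto_0:
  assumes l: "l \<ge> 1" and eta: "0 < \<eta>" "\<eta> \<le> 1" and x: "x > 0"
    and T: "\<And>n. x * real n - 1 \<le> real (T n)" and r: "r > 0" "1 / r < (\<eta> / 2) ^ l / 2 * x"
  shows "(\<lambda>n. tail l \<eta> n r (T n)) \<longlonglongrightarrow> 0"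
proof -
  define p where "p = (\<eta> / 2) ^ l / 2"
  define b where "b = (\<eta> / (2 * real l)) ^ l"
  define d where "d = p * x - 1 / r"
  define d' where "d' = b * x"
  have p: "0 \<le> p" "p \<le> 1"
    using eta power_le_one[of "\<eta> / 2" l] by (auto simp: p_def)
  have b: "0 < b" "b \<le> 1"
  proof -
    have "0 < \<eta> / (2 * real l)" "\<eta> / (2 * real l) \<le> 1" using eta l by (auto simp: field_simps)
    then show "0 < b" "b \<le> 1" unfolding b_def by (auto intro: power_le_one)
  qed
  have d: "d > 0" using r by (simp add: d_def p_def)
  have d': "d' > 0" using b x by (simp add: d'_def)
  have up: "tail l \<eta> n r (T n) \<le> exp p * exp (- d * real n) + exp b * (real n ^ 2 * exp (- d' * real n))" for n
  proof -
    have "2 powr (real n / r) = exp (real n / r * ln 2)" by (simp add: powr_def)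
    also have "\<dots> \<le> exp (real n / r)"
      using mult_left_mono[of "ln 2" 1 "real n / r"] ln_2_less_1 r by simp
    finally have "2 powr (real n / r) * (1 - p) ^ T n \<le> exp (real n / r) * exp (- p * (x * real n - 1))"
      using one_minus_power_le_exp[OF p T] p by (intro mult_mono) auto
    also have "\<dots> = exp p * exp (- d * real n)"
      by (simp add: d_def algebra_simps flip: exp_add)
    finally have 1: "2 powr (real n / r) * (1 - p) ^ T n \<le> exp p * exp (- d * real n)" .
    have "real n ^ 2 * (1 - b) ^ T n \<le> real n ^ 2 * exp (- b * (x * real n - 1))"
      using one_minus_power_le_exp[OF _ b(2) T] b by (intro mult_left_mono) auto
    also have "exp (- b * (x * real n - 1)) = exp b * exp (- d' * real n)"
      by (simp add: d'_def algebra_simps flip: exp_add)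
    finally show ?thesis using 1 by (simp add: tail_def p_def b_def mult_ac)
  qed
  have lim: "(\<lambda>n. exp p * exp (- d * real n) + exp b * (real n ^ 2 * exp (- d' * real n))) \<longlonglongrightarrow> 0"
  proof -
    have "(\<lambda>n. exp (- d * real n)) \<longlonglongrightarrow> 0" using d by real_asymp
    moreover have "(\<lambda>n. real n ^ 2 * exp (- d' * real n)) \<longlonglongrightarrow> 0" using d' by real_asymp
    ultimately show ?thesis by (intro tendsto_add_zero tendsto_mult_right_zero)
  qed
  show ?thesis
  proof (rule tendsto_sandwich[OF _ _ tendsto_const lim])
    show "\<forall>\<^sub>F n in sequentially. 0 \<le> tail l \<eta> n r (T n)"
      using p b by (auto simp: tail_def p_def b_def)
    show "\<forall>\<^sub>F n in sequentially. tail l \<eta> n r (T n) \<le>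
        exp p * exp (- d * real n) + exp b * (real n ^ 2 * exp (- d' * real n))"
      using up by simp
  qed
qed

section \<open>The random graph process\<close>

locale vertex_rule = prob_space M for M :: "'a measure" +
  fixes l n :: nat and F :: "nat \<Rightarrow> 'a measure" and v :: "nat \<Rightarrow> 'a \<Rightarrow> nat \<Rightarrow> nat"
    and E :: "nat \<Rightarrow> 'a \<Rightarrow> nat set set"
  assumes rule: "l_vertex_rule l n M F v E" and n_pos: "n \<ge> 1"
begin

section \<open>Consequences of the rule and measurability of the graphs\<close>

abbreviation "G \<equiv> rgraph E"

text \<open>A finite set containing every value of \<open>G\<close>, so that conditioning on the
  past becomes summation over finitely many graphs.\<close>

abbreviation "graphs \<equiv> Pow (Pow {..<n})"

text \<open>Restriction makes the tuple an extensional function, hence an element of the finite set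
  \<open>{..<l} \<rightarrow>\<^sub>E {..<n}\<close>, on which it is uniform.\<close>

definition tup :: "nat \<Rightarrow> 'a \<Rightarrow> nat \<Rightarrow> nat" where
  "tup m \<omega> = restrict (v m \<omega>) {..<l}"

lemma space_F: "space (F m) = space M"
  using rule[unfolded l_vertex_rule_def, THEN conjunct2, THEN conjunct2, THEN conjunct1] unfolding subalgebra_def by blast

lemma sets_F: "A \<in> sets (F m) \<Longrightarrow> A \<in> sets M"
  using rule[unfolded l_vertex_rule_def, THEN conjunct2, THEN conjunct2, THEN conjunct1] unfolding subalgebra_def by blast

lemma sets_F_mono: "i \<le> j \<Longrightarrow> A \<in> sets (F i) \<Longrightarrow> A \<in> sets (F j)"
  using rule[unfolded l_vertex_rule_def, THEN conjunct2, THEN conjunct1] unfolding filtration_def by blast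

lemma v_less: "m \<ge> 1 \<Longrightarrow> \<omega> \<in> space M \<Longrightarrow> i < l \<Longrightarrow> v m \<omega> i < n"
  using rule[unfolded l_vertex_rule_def, THEN conjunct2, THEN conjunct2, THEN conjunct2, THEN conjunct1] by blast

lemma v_measurable: "m \<ge> 1 \<Longrightarrow> i < l \<Longrightarrow> (\<lambda>\<omega>. v m \<omega> i) \<in> measurable (F m) (count_space UNIV)"
  using rule[unfolded l_vertex_rule_def, THEN conjunct2, THEN conjunct2, THEN conjunct2, THEN conjunct2, THEN conjunct1] by blast

lemma v_indep:
  "A \<in> sets (F m) \<Longrightarrow> (\<And>i. i < l \<Longrightarrow> t i < n) \<Longrightarrow>
    prob (A \<inter> {\<omega> \<in> space M. \<forall>i<l. v (Suc m) \<omega> i = t i}) = prob A / real n ^ l"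
  using rule[unfolded l_vertex_rule_def, THEN conjunct2, THEN conjunct2, THEN conjunct2, THEN conjunct2, THEN conjunct2, THEN conjunct1] by blast

lemma E_measurable: "m \<ge> 1 \<Longrightarrow> E m \<in> measurable (F m) (count_space UNIV)"
  using rule[unfolded l_vertex_rule_def, THEN conjunct2, THEN conjunct2, THEN conjunct2, THEN conjunct2, THEN conjunct2, THEN conjunct2, THEN conjunct1] by blast

lemma E_edge:
  "m \<ge> 1 \<Longrightarrow> \<omega> \<in> space M \<Longrightarrow> e \<in> E m \<omega> \<Longrightarrow>
    \<exists>i<l. \<exists>j<l. v m \<omega> i \<noteq> v m \<omega> j \<and> e = {v m \<omega> i, v m \<omega> j}"
  using rule[unfolded l_vertex_rule_def, THEN conjunct2, THEN conjunct2, THEN conjunct2, THEN conjunct2, THEN conjunct2, THEN conjunct2, THEN conjunct2, THEN conjunct1] by blast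

lemma E_nonempty:
  "\<omega> \<in> space M \<Longrightarrow>
    (\<And>i j. i < l \<Longrightarrow> j < l \<Longrightarrow> i \<noteq> j \<Longrightarrow> \<not> conn (G m \<omega>) (v (Suc m) \<omega> i) (v (Suc m) \<omega> j)) \<Longrightarrow>
    E (Suc m) \<omega> \<noteq> {}"
  using rule[unfolded l_vertex_rule_def, THEN conjunct2, THEN conjunct2, THEN conjunct2, THEN conjunct2, THEN conjunct2, THEN conjunct2, THEN conjunct2, THEN conjunct2] by blast

lemma E_subset: "m \<ge> 1 \<Longrightarrow> \<omega> \<in> space M \<Longrightarrow> e \<in> E m \<omega> \<Longrightarrow> e \<subseteq> v m \<omega> ` {..<l}"
  using E_edge by fastforce

lemma v_subset: "m \<ge> 1 \<Longrightarrow> \<omega> \<in> space M \<Longrightarrow> v m \<omega> ` {..<l} \<subseteq> {..<n}"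
  using v_less by auto

lemma G_mono: "i \<le> j \<Longrightarrow> G i \<omega> \<subseteq> G j \<omega>"
  by (induction rule: dec_induct) auto

lemma G_graphs: "\<omega> \<in> space M \<Longrightarrow> G m \<omega> \<in> graphs"
proof (induction m)
  case (Suc m)
  have "E (Suc m) \<omega> \<subseteq> Pow {..<n}"
    using E_subset[of "Suc m" \<omega>] v_subset[of "Suc m" \<omega>] Suc.prems by fastforce
  then show ?case using Suc by auto
qed simp

lemma finite_graphs: "finite graphs"
  by simp

lemma measurable_F_mono:
  assumes f: "f \<in> measurable (F i) N" and "i \<le> j"
  shows "f \<in> measurable (F j) N"
proof (rule measurableI)
  show "f x \<in> space N" if "x \<in> space (F j)" for x
    using measurable_space[OF f] that by (simp add: space_F)
  show "f -` A \<inter> space (F j) \<in> sets (F j)" if "A \<in> sets N" for A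
    using sets_F_mono[OF assms(2) measurable_sets[OF f that]] by (simp add: space_F)
qed

lemma G_measurable: "G m \<in> measurable (F m) (count_space graphs)"
proof (induction m)
  case 0
  show ?case by simp
next
  case (Suc m)
  let ?F = "F (Suc m)"
  have m: "G m \<in> measurable ?F (count_space graphs)"
    using Suc by (rule measurable_F_mono) simp
  have E: "E (Suc m) \<in> measurable ?F (count_space graphs)"
  proof (rule measurableI)
    show "E (Suc m) \<omega> \<in> space (count_space graphs)" if "\<omega> \<in> space ?F" for \<omega>
      using G_graphs[of \<omega> "Suc m"] that by (simp add: space_F)
    show "E (Suc m) -` A \<inter> space ?F \<in> sets ?F" for A
      by (rule measurable_sets[OF E_measurable]) simp_all
  qed
  have "(\<lambda>\<omega>. (\<lambda>g \<omega>. g \<union> E (Suc m) \<omega>) (G m \<omega>) \<omega>) \<in> measurable ?F (count_space graphs)"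
  proof (rule measurable_compose_countable'[OF _ m])
    show "(\<lambda>\<omega>. g \<union> E (Suc m) \<omega>) \<in> measurable ?F (count_space graphs)" if "g \<in> graphs" for g
      using that by (intro measurable_compose[OF E]) auto
    show "countable graphs" by (intro countable_finite finite_graphs)
  qed
  then show ?case by simp
qed

lemma G_event:
  assumes sm: "s \<le> m"
  shows "{\<omega> \<in> space M. P (G s \<omega>) (G m \<omega>)} \<in> sets (F m)"
proof -
  have 1: "{\<omega> \<in> space M. G i \<omega> = g} \<in> sets (F m)" if "i \<le> m" "g \<in> graphs" for i g
    using measurable_sets[OF measurable_F_mono[OF G_measurable that(1)], of "{g}"] that(2)
    by (simp add: vimage_def space_F Int_def conj_commute)
  have "{\<omega> \<in> space M. P (G s \<omega>) (G m \<omega>)} =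
    (\<Union>(g, h) \<in> {(g, h) \<in> graphs \<times> graphs. P g h}.
      {\<omega> \<in> space M. G s \<omega> = g} \<inter> {\<omega> \<in> space M. G m \<omega> = h})"
    using G_graphs by auto
  also have "\<dots> \<in> sets (F m)"
  proof (rule sets.finite_UN)
    show "finite {(g, h) \<in> graphs \<times> graphs. P g h}"
      by (rule finite_subset[of _ "graphs \<times> graphs"]) auto
  qed (use 1 sm in auto)
  finally show ?thesis .
qed

section \<open>Uniformity of the next tuple given the past\<close>

lemma tup_eq_iff:
  assumes "t \<in> {..<l} \<rightarrow>\<^sub>E {..<n}"
  shows "tup m \<omega> = t \<longleftrightarrow> (\<forall>i<l. v m \<omega> i = t i)"
proof
  assume "tup m \<omega> = t"
  then show "\<forall>i<l. v m \<omega> i = t i" by (auto simp: tup_def)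
next
  assume a: "\<forall>i<l. v m \<omega> i = t i"
  show "tup m \<omega> = t"
    unfolding tup_def
  proof
    fix i
    show "restrict (v m \<omega>) {..<l} i = t i"
      using a PiE_arb[OF assms, of i] by (cases "i < l") simp_all
  qed
qed

lemma tup_event:
  assumes S: "S \<subseteq> {..<l} \<rightarrow>\<^sub>E {..<n}"
  shows "{\<omega> \<in> space M. tup (Suc m) \<omega> \<in> S} \<in> sets (F (Suc m))"
proof -
  let ?F = "F (Suc m)"
  have fin: "finite S" using S by (rule finite_subset) (auto intro: finite_PiE)
  have "{\<omega> \<in> space M. tup (Suc m) \<omega> = t} \<in> sets ?F" if "t \<in> S" for t
  proof -
    have t: "t \<in> {..<l} \<rightarrow>\<^sub>E {..<n}" using that S by (rule subsetD[rotated])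
    have "{\<omega> \<in> space M. v (Suc m) \<omega> i = t i} \<in> sets ?F" if "i \<in> {..<l}" for i
    proof -
      have "(\<lambda>\<omega>. v (Suc m) \<omega> i) -` {t i} \<inter> space ?F \<in> sets ?F"
        by (rule measurable_sets[OF v_measurable]) (use that in simp_all)
      moreover have "(\<lambda>\<omega>. v (Suc m) \<omega> i) -` {t i} \<inter> space ?F = {\<omega> \<in> space M. v (Suc m) \<omega> i = t i}"
        unfolding space_F by blast
      ultimately show ?thesis by (simp only:)
    qed
    then have "{\<omega> \<in> space M. \<forall>i\<in>{..<l}. v (Suc m) \<omega> i = t i} \<in> sets ?F"
      using sets.sets_Collect_finite_All[of "{..<l}" ?F "\<lambda>i \<omega>. v (Suc m) \<omega> i = t i"]
      unfolding space_F by blast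
    then show ?thesis unfolding tup_eq_iff[OF t] by (simp only: Ball_def lessThan_iff)
  qed
  then have "(\<Union>t\<in>S. {\<omega> \<in> space M. tup (Suc m) \<omega> = t}) \<in> sets ?F"
    using fin by (intro sets.finite_UN)
  moreover have "(\<Union>t\<in>S. {\<omega> \<in> space M. tup (Suc m) \<omega> = t}) = {\<omega> \<in> space M. tup (Suc m) \<omega> \<in> S}"
    by blast
  ultimately show ?thesis by (simp only:)
qed

lemma prob_tup:
  assumes A: "A \<in> sets (F m)" and S: "S \<subseteq> {..<l} \<rightarrow>\<^sub>E {..<n}"
  shows "prob (A \<inter> {\<omega> \<in> space M. tup (Suc m) \<omega> \<in> S}) = prob A * real (card S) / real n ^ l"
proof -
  have fin: "finite S" using S by (rule finite_subset) (auto intro: finite_PiE)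
  let ?B = "\<lambda>t. A \<inter> {\<omega> \<in> space M. tup (Suc m) \<omega> = t}"
  have "prob (\<Union>t\<in>S. ?B t) = (\<Sum>t\<in>S. prob (?B t))"
  proof (rule finite_measure_finite_Union[OF fin])
    have "{\<omega> \<in> space M. tup (Suc m) \<omega> \<in> {t}} \<in> events" if "t \<in> S" for t
      by (rule sets_F, rule tup_event) (use that S in blast)
    then have "?B t \<in> events" if "t \<in> S" for t
      using that by (intro sets.Int sets_F[OF A]) simp
    then show "?B ` S \<subseteq> events" by (rule image_subsetI)
  qed (auto simp: disjoint_family_on_def)
  also have "\<dots> = (\<Sum>t\<in>S. prob A / real n ^ l)"
  proof (rule sum.cong)
    fix t assume "t \<in> S"
    then have t: "t \<in> {..<l} \<rightarrow>\<^sub>E {..<n}" using S by (rule subsetD[rotated])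
    then have "t i < n" if "i < l" for i using that by (auto dest: PiE_mem)
    from v_indep[OF A this] show "prob (?B t) = prob A / real n ^ l"
      unfolding tup_eq_iff[OF t] by simp
  qed simp
  also have "\<dots> = prob A * real (card S) / real n ^ l" by simp
  also have "(\<Union>t\<in>S. ?B t) = A \<inter> {\<omega> \<in> space M. tup (Suc m) \<omega> \<in> S}" by auto
  finally show ?thesis .
qed

section \<open>Expectations of functions of two graphs\<close>

lemma integrable_G:
  fixes f :: "nat set set \<Rightarrow> nat set set \<Rightarrow> real"
  assumes "s \<le> m" and "D \<in> events"
  shows "integrable M (\<lambda>\<omega>. f (G s \<omega>) (G m \<omega>) * indicator D \<omega>)" (is ?I)
    and "(\<integral>\<omega>. f (G s \<omega>) (G m \<omega>) * indicator D \<omega> \<partial>M) =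
      (\<Sum>(g, h)\<in>graphs \<times> graphs. f g h * prob ({\<omega> \<in> space M. G s \<omega> = g \<and> G m \<omega> = h} \<inter> D))" (is ?E)
proof -
  let ?A = "\<lambda>(g, h). {\<omega> \<in> space M. G s \<omega> = g \<and> G m \<omega> = h}"
  let ?f = "\<lambda>p \<omega>. (case p of (g, h) \<Rightarrow> f g h) * indicator (?A p \<inter> D) \<omega>"
  have fin: "finite (graphs \<times> graphs)" by simp
  have A: "?A p \<in> events" for p
    using sets_F[OF G_event[OF assms(1), of "\<lambda>x y. x = fst p \<and> y = snd p"]]
    by (simp add: case_prod_beta)
  have eq: "f (G s \<omega>) (G m \<omega>) * indicator D \<omega> = (\<Sum>p\<in>graphs \<times> graphs. ?f p \<omega>)"
    if "\<omega> \<in> space M" for \<omega>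
  proof -
    have "(\<Sum>p\<in>graphs \<times> graphs. ?f p \<omega>) = (\<Sum>p\<in>{(G s \<omega>, G m \<omega>)}. ?f p \<omega>)"
      using G_graphs[OF that] fin by (intro sum.mono_neutral_right) (auto simp: indicator_def)
    then show ?thesis using that by (simp add: indicator_def)
  qed
  have int: "integrable M (?f p)" for p
    using A[of p] assms(2) by (intro integrable_mult_right integrable_real_indicator)
      (auto simp: emeasure_eq_measure)
  have "integrable M (\<lambda>\<omega>. \<Sum>p\<in>graphs \<times> graphs. ?f p \<omega>)"
    using int by (intro Bochner_Integration.integrable_sum) auto
  then show ?I using eq by (subst Bochner_Integration.integrable_cong[OF refl]) auto
  have "(\<integral>\<omega>. f (G s \<omega>) (G m \<omega>) * indicator D \<omega> \<partial>M) =
      (\<integral>\<omega>. (\<Sum>p\<in>graphs \<times> graphs. ?f p \<omega>) \<partial>M)"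
    using eq by (intro Bochner_Integration.integral_cong) auto
  also have "\<dots> = (\<Sum>p\<in>graphs \<times> graphs. \<integral>\<omega>. ?f p \<omega> \<partial>M)"
    using int by (intro Bochner_Integration.integral_sum) auto
  also have "\<dots> = (\<Sum>p\<in>graphs \<times> graphs. (case p of (g, h) \<Rightarrow> f g h) * prob (?A p \<inter> D))"
    using A assms(2) by (intro sum.cong) auto
  finally show ?E by (simp add: case_prod_beta)
qed

text \<open>On each event fixing \<open>G s\<close> and \<open>G m\<close> to be \<open>g\<close>
  and \<open>h\<close>, which lies in \<open>F m\<close>, the next tuple is uniform and hits
  \<open>S g h\<close> with probability at least \<open>p\<close> wherever \<open>f g h\<close> is
  positive. Summing over the pairs replaces conditional expectation.\<close>

lemma expectation_tup_ge:
  fixes f :: "nat set set \<Rightarrow> nat set set \<Rightarrow> real"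
  assumes "s \<le> m"
    and S: "\<And>g h. S g h \<subseteq> {..<l} \<rightarrow>\<^sub>E {..<n}"
    and f: "\<And>g h. f g h \<ge> 0"
    and p: "\<And>g h. f g h > 0 \<Longrightarrow> p * real n ^ l \<le> real (card (S g h))"
    and D: "D = {\<omega> \<in> space M. tup (Suc m) \<omega> \<in> S (G s \<omega>) (G m \<omega>)}"
  shows "D \<in> events"
    and "p * (\<integral>\<omega>. f (G s \<omega>) (G m \<omega>) \<partial>M) \<le> (\<integral>\<omega>. f (G s \<omega>) (G m \<omega>) * indicator D \<omega> \<partial>M)"
proof -
  let ?A = "\<lambda>g h. {\<omega> \<in> space M. G s \<omega> = g \<and> G m \<omega> = h}"
  let ?B = "\<lambda>g h. {\<omega> \<in> space M. tup (Suc m) \<omega> \<in> S g h}"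
  have A: "?A g h \<in> sets (F m)" for g h using G_event[OF assms(1)] by simp
  have B: "?B g h \<in> events" for g h by (rule sets_F, rule tup_event, rule S)
  have "D = (\<Union>(g, h)\<in>graphs \<times> graphs. ?A g h \<inter> ?B g h)"
    using G_graphs by (auto simp: D)
  also have "\<dots> \<in> events"
    using A[THEN sets_F] B by (intro sets.finite_UN) (auto simp del: Pow_iff)
  finally show De: "D \<in> events" .
  have "p * (\<integral>\<omega>. f (G s \<omega>) (G m \<omega>) \<partial>M) =
      p * (\<integral>\<omega>. f (G s \<omega>) (G m \<omega>) * indicator (space M) \<omega> \<partial>M)"
    by (intro arg_cong[where f = "\<lambda>x. p * x"] Bochner_Integration.integral_cong) auto
  also have "\<dots> = (\<Sum>(g, h)\<in>graphs \<times> graphs. p * (f g h * prob (?A g h \<inter> space M)))"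
    using integrable_G(2)[OF assms(1) sets.top, of f] by (simp add: sum_distrib_left case_prod_beta)
  also have "\<dots> \<le> (\<Sum>(g, h)\<in>graphs \<times> graphs. f g h * prob (?A g h \<inter> D))"
  proof (intro sum_mono, clarify)
    fix g h
    have "?A g h \<inter> D = ?A g h \<inter> ?B g h" by (auto simp: D)
    then have eq: "prob (?A g h \<inter> D) = prob (?A g h) * (real (card (S g h)) / real n ^ l)"
      using prob_tup[OF A S] by simp
    show "p * (f g h * prob (?A g h \<inter> space M)) \<le> f g h * prob (?A g h \<inter> D)"
    proof (cases "f g h > 0")
      case True
      have "p \<le> real (card (S g h)) / real n ^ l"
        using p[OF True] n_pos by (simp add: field_simps)
      then have "f g h * prob (?A g h) * p \<le> f g h * prob (?A g h) * (real (card (S g h)) / real n ^ l)"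
        using f by (intro mult_left_mono) auto
      moreover have "?A g h \<inter> space M = ?A g h" by auto
      ultimately show ?thesis unfolding eq by (simp add: mult_ac)
    qed (use f[of g h] in simp)
  qed
  also have "\<dots> = (\<integral>\<omega>. f (G s \<omega>) (G m \<omega>) * indicator D \<omega> \<partial>M)"
    using integrable_G(2)[OF assms(1) De, of f] by simp
  finally show "p * (\<integral>\<omega>. f (G s \<omega>) (G m \<omega>) \<partial>M) \<le> (\<integral>\<omega>. f (G s \<omega>) (G m \<omega>) * indicator D \<omega> \<partial>M)" .
qed

subsection \<open>Emergence of a giant component\<close>

lemma integrable_G':
  fixes f :: "nat set set \<Rightarrow> nat set set \<Rightarrow> real"
  assumes "s \<le> m"
  shows "integrable M (\<lambda>\<omega>. f (G s \<omega>) (G m \<omega>))"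
proof -
  have "integrable M (\<lambda>\<omega>. f (G s \<omega>) (G m \<omega>) * indicator (space M) \<omega>)"
    by (rule integrable_G(1)[OF assms sets.top])
  then show ?thesis by (subst (asm) Bochner_Integration.integrable_cong[OF refl]) auto
qed

text \<open>While \<open>\<eta> * real n\<close> vertices of the starting set are outside
  linear-sized components, a tuple spread over them occurs with probability at least
  \<open>(\<eta> / 2) ^ l\<close>, forces an edge and lowers the number of components meeting the
  starting set. Markov's inequality for an exponential potential of that number gives the
  bound.\<close>

lemma powder_keg:
  assumes l: "l \<ge> 1" and eta: "0 < \<eta>" "\<eta> \<le> 1" and r: "r > 0" and \<beta>: "\<beta> = \<eta> / (2 * real l)"
  shows "prob {\<omega> \<in> space M. \<eta> * real n \<le> real (card (large n (G s \<omega>) r - large n (G (s + T) \<omega>) (\<beta> * real n)))}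
    \<le> 2 powr (real n / r) * (1 - (\<eta> / 2) ^ l / 2) ^ T"
proof -
  define p where "p = (\<eta> / 2) ^ l"
  have p: "0 \<le> p" "p \<le> 1" using eta by (auto simp: p_def intro!: power_le_one)
  define R where "R g h = large n g r - large n h (\<beta> * real n)" for g h
  \<comment> \<open>The exponential potential \<open>Z (G s) (G m)\<close> contracts in mean by \<open>1 - p / 2\<close> per step.\<close>
  define Z where "Z g h = (if \<eta> * real n \<le> real (card (R g h)) then 2 ^ card (comp n h ` large n g r) else (0::real))"
    for g h
  define S where "S g h = spread h (R g h) l" for g h
  have Rn: "R g h \<subseteq> {..<n}" for g h using large_subset[of n g r] by (auto simp: R_def)
  have Z0: "Z g h \<ge> 0" for g h by (simp add: Z_def)
  have S: "S g h \<subseteq> {..<l} \<rightarrow>\<^sub>E {..<n}" for g h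
    using Rn[of g h] PiE_mono[of "{..<l}" "\<lambda>_. R g h" "\<lambda>_. {..<n}"] by (auto simp: S_def spread_def)
  have \<beta>0: "0 \<le> \<beta> * real n" using eta by (simp add: \<beta>)
  \<comment> \<open>The value of \<open>\<beta>\<close> is such that \<open>l\<close> components of
    size \<open>\<beta> * real n\<close> cover only half of \<open>\<eta> * real n\<close>; the
    other half remains available to each entry.\<close>
  have l\<beta>: "real l * (\<beta> * real n) = \<eta> / 2 * real n" using l by (simp add: \<beta>)
  have cS: "p * real n ^ l \<le> real (card (S g h))" if "Z g h > 0" for g h
  proof -
    have "\<eta> * real n \<le> real (card (R g h))" using that by (simp add: Z_def split: if_splits)
    then have "(\<eta> * real n - real l * (\<beta> * real n)) ^ l \<le> real (card (S g h))"
      unfolding S_def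
    proof (rule card_spread[OF Rn])
      show "real (card (comp n h x)) \<le> \<beta> * real n" if "x \<in> R g h" for x
        using that by (auto simp: R_def large_def)
      show "real l * (\<beta> * real n) \<le> \<eta> * real n" unfolding l\<beta> using eta by simp
    qed (use \<beta>0 in auto)
    also have "\<eta> * real n - real l * (\<beta> * real n) = \<eta> / 2 * real n" unfolding l\<beta> by simp
    finally show ?thesis by (simp add: p_def power_mult_distrib power_divide)
  qed
  define e where "e m = (\<integral>\<omega>. Z (G s \<omega>) (G m \<omega>) \<partial>M)" for m
  have step: "e (Suc m) \<le> (1 - p / 2) * e m" if "s \<le> m" for m
  proof -
    define D where "D = {\<omega> \<in> space M. tup (Suc m) \<omega> \<in> S (G s \<omega>) (G m \<omega>)}"
    note D = expectation_tup_ge[OF that S, of Z p, OF Z0 cS D_def]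
    \<comment> \<open>Pathwise, the component count drops by at least one on \<open>D\<close>, which
      halves \<open>Z\<close>, and cannot grow off \<open>D\<close>. Once fewer than
      \<open>\<eta> * real n\<close> vertices are left over, \<open>Z\<close> vanishes.\<close>
    have le: "Z (G s \<omega>) (G (Suc m) \<omega>) \<le> Z (G s \<omega>) (G m \<omega>) - 1 / 2 * (Z (G s \<omega>) (G m \<omega>) * indicator D \<omega>)"
      if \<omega>: "\<omega> \<in> space M" for \<omega>
    proof (cases "\<eta> * real n \<le> real (card (R (G s \<omega>) (G (Suc m) \<omega>)))")
      case True
      let ?W = "large n (G s \<omega>) r"
      let ?c = "\<lambda>m. card (comp n (G m \<omega>) ` ?W)"
      have GS: "G m \<omega> \<subseteq> G (Suc m) \<omega>" by auto
      have W: "?W \<subseteq> {..<n}" by (rule large_subset)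
      have "R (G s \<omega>) (G (Suc m) \<omega>) \<subseteq> R (G s \<omega>) (G m \<omega>)"
        unfolding R_def using large_mono[OF GS] by blast
      then have "card (R (G s \<omega>) (G (Suc m) \<omega>)) \<le> card (R (G s \<omega>) (G m \<omega>))"
        by (intro card_mono) (auto simp: R_def)
      then have Zm: "Z (G s \<omega>) (G m \<omega>) = 2 ^ ?c m" "Z (G s \<omega>) (G (Suc m) \<omega>) = 2 ^ ?c (Suc m)"
        using True by (auto simp: Z_def)
      show ?thesis
      proof (cases "\<omega> \<in> D")
        case False
        have "?c (Suc m) \<le> ?c m" by (rule card_comps_mono[OF GS W])
        then show ?thesis using False unfolding Zm by simp
      next
        case True
        then have t: "tup (Suc m) \<omega> \<in> spread (G m \<omega>) (R (G s \<omega>) (G m \<omega>)) l"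
          by (simp add: D_def S_def)
        have vt: "v (Suc m) \<omega> i = tup (Suc m) \<omega> i" if "i < l" for i using that by (simp add: tup_def)
        have nc: "\<not> conn (G m \<omega>) (v (Suc m) \<omega> i) (v (Suc m) \<omega> j)" if "i < l" "j < l" "i \<noteq> j" for i j
          using t that by (simp add: vt spread_def)
        have vW: "v (Suc m) \<omega> i \<in> ?W" if "i < l" for i
        proof -
          have "tup (Suc m) \<omega> i \<in> R (G s \<omega>) (G m \<omega>)" using t that by (auto simp: spread_def)
          then show ?thesis by (simp add: vt[OF that] R_def)
        qed
        \<comment> \<open>The entries lie in distinct components, so an edge must appear, and it
          joins two components that both meet \<open>?W\<close>.\<close>
        obtain edge where edge: "edge \<in> E (Suc m) \<omega>" using E_nonempty[OF \<omega> nc] by blast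
        then obtain i j where ij: "i < l" "j < l" "v (Suc m) \<omega> i \<noteq> v (Suc m) \<omega> j"
          "edge = {v (Suc m) \<omega> i, v (Suc m) \<omega> j}"
          using E_edge[of "Suc m" \<omega> edge] \<omega> by auto
        have "conn (G (Suc m) \<omega>) (v (Suc m) \<omega> i) (v (Suc m) \<omega> j)"
          using edge ij by (intro conn_edge) auto
        then have "?c (Suc m) < ?c m"
          using ij nc[of i j] vW by (intro card_comps_less[OF GS W, of "v (Suc m) \<omega> i" "v (Suc m) \<omega> j"]) auto
        then have "(2::real) ^ Suc (?c (Suc m)) \<le> 2 ^ ?c m" by (intro power_increasing) auto
        then show ?thesis using True unfolding Zm by simp
      qed
    next
      case False
      then have "Z (G s \<omega>) (G (Suc m) \<omega>) = 0" by (simp add: Z_def)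
      then show ?thesis using Z0[of "G s \<omega>" "G m \<omega>"] by (simp add: indicator_def)
    qed
    have i0: "integrable M (\<lambda>\<omega>. Z (G s \<omega>) (G m \<omega>))" using that by (rule integrable_G')
    have i1: "integrable M (\<lambda>\<omega>. Z (G s \<omega>) (G m \<omega>) * indicator D \<omega>)"
      by (rule integrable_G(1)[OF that D(1)])
    have "e (Suc m) \<le> (\<integral>\<omega>. Z (G s \<omega>) (G m \<omega>) - 1 / 2 * (Z (G s \<omega>) (G m \<omega>) * indicator D \<omega>) \<partial>M)"
      unfolding e_def
    proof (rule integral_mono[OF _ _ le])
      show "integrable M (\<lambda>\<omega>. Z (G s \<omega>) (G (Suc m) \<omega>))"
        by (rule integrable_G') (use that in simp)
      show "integrable M (\<lambda>\<omega>. Z (G s \<omega>) (G m \<omega>) - 1 / 2 * (Z (G s \<omega>) (G m \<omega>) * indicator D \<omega>))"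
        by (rule Bochner_Integration.integrable_diff[OF i0 integrable_mult_right[OF i1]])
    qed
    also have "\<dots> = e m - 1 / 2 * (\<integral>\<omega>. Z (G s \<omega>) (G m \<omega>) * indicator D \<omega> \<partial>M)"
      unfolding e_def using i0 i1 by (subst Bochner_Integration.integral_diff) auto
    also have "\<dots> \<le> e m - 1 / 2 * (p * e m)"
      using D(2) unfolding e_def by linarith
    finally show ?thesis by (simp add: algebra_simps)
  qed
  have iter: "e (s + T) \<le> (1 - p / 2) ^ T * e s"
  proof (induction T)
    case (Suc T)
    have "e (s + Suc T) \<le> (1 - p / 2) * e (s + T)" using step[of "s + T"] by simp
    also have "\<dots> \<le> (1 - p / 2) * ((1 - p / 2) ^ T * e s)" using Suc p by (intro mult_left_mono) auto
    finally show ?case by (simp add: mult_ac)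
  qed simp
  have "e s \<le> 2 powr (real n / r)"
    unfolding e_def
  proof (rule integral_le_const)
    show "integrable M (\<lambda>\<omega>. Z (G s \<omega>) (G s \<omega>))" by (rule integrable_G') simp
    have "Z g g \<le> 2 powr (real n / r)" for g
    proof -
      have "real (card (comp n g ` large n g r)) \<le> real n / r"
        using card_comps_large[of r n g] r by (simp add: field_simps)
      then have "2 powr real (card (comp n g ` large n g r)) \<le> 2 powr (real n / r)"
        by (intro powr_mono) auto
      then show ?thesis by (simp add: Z_def powr_realpow)
    qed
    then show "AE \<omega> in M. Z (G s \<omega>) (G s \<omega>) \<le> 2 powr (real n / r)" by simp
  qed
  then have eT: "e (s + T) \<le> (1 - p / 2) ^ T * 2 powr (real n / r)"
    using iter p by (auto intro: order_trans mult_left_mono)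
  let ?A = "{\<omega> \<in> space M. \<eta> * real n \<le> real (card (R (G s \<omega>) (G (s + T) \<omega>)))}"
  have A: "?A \<in> events" by (rule sets_F[OF G_event]) simp
  have "prob ?A = (\<integral>\<omega>. indicator ?A \<omega> \<partial>M)" using A by simp
  \<comment> \<open>Markov's inequality: on \<open>?A\<close> the potential is a power of two, hence
    at least \<open>1\<close>.\<close>
  also have "\<dots> \<le> e (s + T)"
    unfolding e_def
  proof (rule integral_mono)
    show "integrable M (\<lambda>\<omega>. indicator ?A \<omega> :: real)"
      using A by (intro integrable_real_indicator) (auto simp: emeasure_eq_measure)
    show "integrable M (\<lambda>\<omega>. Z (G s \<omega>) (G (s + T) \<omega>))" by (rule integrable_G') simp
    show "indicator ?A \<omega> \<le> Z (G s \<omega>) (G (s + T) \<omega>)" for \<omega>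
      by (auto simp: Z_def indicator_def)
  qed
  finally show ?thesis using eT unfolding p_def R_def by (simp add: mult.commute)
qed

text \<open>The event at stage \<open>T\<close> lies in \<open>F (s + T)\<close> and components
  never shrink, so the merging property applies at every step and removes a fraction of at least
  \<open>\<beta> ^ l\<close> of the remaining probability.\<close>

lemma merging_tail:
  assumes mrg: "merging l n M F E" and \<beta>: "0 < \<beta>" "\<beta> \<le> 1" and xy: "x < n" "y < n"
  shows "prob {\<omega> \<in> space M. x \<in> large n (G s \<omega>) (\<beta> * real n) \<and> y \<in> large n (G s \<omega>) (\<beta> * real n)
      \<and> \<not> conn (G (s + T) \<omega>) x y} \<le> (1 - \<beta> ^ l) ^ T"
proof (induction T)
  case 0
  show ?case by simp
next
  case (Suc T)
  define P where "P g h \<longleftrightarrow> x \<in> large n g (\<beta> * real n) \<and> y \<in> large n g (\<beta> * real n) \<and> \<not> conn h x y" for g h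
  define A where "A T = {\<omega> \<in> space M. P (G s \<omega>) (G (s + T) \<omega>)}" for T
  define C where "C = {\<omega> \<in> space M. conn (G (Suc (s + T)) \<omega>) x y}"
  have AF: "A T \<in> sets (F (s + T))" for T unfolding A_def by (rule G_event) simp
  have Ae: "A T \<in> events" for T by (rule sets_F[OF AF])
  have Ce: "C \<in> events"
    unfolding C_def by (rule sets_F, rule G_event[of "Suc (s + T)" "Suc (s + T)" "\<lambda>_ h. conn h x y"]) simp
  have sub: "subalgebra M (F (s + T))"
    unfolding subalgebra_def using space_F sets_F by blast
  interpret sub: finite_measure_subalgebra M "F (s + T)"
    by unfold_locales (rule sub)
  have intC: "integrable M (indicator C :: 'a \<Rightarrow> real)"
    using Ce by (intro integrable_real_indicator) (auto simp: emeasure_eq_measure)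
  \<comment> \<open>On \<open>A T\<close> both vertices lie in distinct components of size at least
    \<open>\<beta> * real n\<close> at time \<open>s + T\<close>; off \<open>A T\<close> both sides
    are zero.\<close>
  have ae: "AE \<omega> in M. \<beta> ^ l * indicator (A T) \<omega> \<le> indicator (A T) \<omega> * real_cond_exp M (F (s + T)) (indicator C) \<omega>"
    using mrg[unfolded merging_def, rule_format, OF \<beta>(1), of x y "s + T"]
  proof eventually_elim
    case (elim \<omega>)
    show ?case
    proof (cases "\<omega> \<in> A T")
      case True
      have "large n (G s \<omega>) (\<beta> * real n) \<subseteq> large n (G (s + T) \<omega>) (\<beta> * real n)"
        by (rule large_mono[OF G_mono]) simp
      then have "x \<in> large n (G (s + T) \<omega>) (\<beta> * real n)" "y \<in> large n (G (s + T) \<omega>) (\<beta> * real n)"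
        and "\<not> conn (G (s + T) \<omega>) x y"
        using True unfolding A_def P_def by auto
      then show ?thesis using elim True unfolding C_def large_def by simp
    qed simp
  qed
  have "\<beta> ^ l * prob (A T) = (\<integral>\<omega>. \<beta> ^ l * indicator (A T) \<omega> \<partial>M)"
    using Ae by simp
  also have "\<dots> \<le> (\<integral>\<omega>. indicator (A T) \<omega> * real_cond_exp M (F (s + T)) (indicator C) \<omega> \<partial>M)"
  proof (rule integral_mono_AE[OF _ _ ae])
    show "integrable M (\<lambda>\<omega>. \<beta> ^ l * indicator (A T) \<omega>)"
      using Ae by (intro integrable_mult_right integrable_real_indicator) (auto simp: emeasure_eq_measure)
    show "integrable M (\<lambda>\<omega>. indicator (A T) \<omega> * real_cond_exp M (F (s + T)) (indicator C) \<omega>)"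
      using integrable_mult_indicator[OF Ae sub.real_cond_exp_int(1)[OF intC], of T] by simp
  qed
  \<comment> \<open>The defining property of conditional expectation, applicable since
    \<open>A T\<close> belongs to \<open>F (s + T)\<close>.\<close>
  also have "\<dots> = (\<integral>\<omega>. indicator (A T) \<omega> * indicator C \<omega> \<partial>M)"
    using sub.real_cond_exp_intA[OF intC AF] unfolding set_lebesgue_integral_def by simp
  also have "\<dots> = (\<integral>\<omega>. indicator (A T \<inter> C) \<omega> \<partial>M)"
    by (simp add: indicator_inter_arith)
  also have "\<dots> = prob (A T \<inter> C)" using Ae Ce by simp
  finally have AC: "\<beta> ^ l * prob (A T) \<le> prob (A T \<inter> C)" .
  have "A (Suc T) \<subseteq> A T - (A T \<inter> C)"
  proof
    fix \<omega> assume "\<omega> \<in> A (Suc T)"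
    moreover have "conn (G (s + T) \<omega>) x y \<Longrightarrow> conn (G (Suc (s + T)) \<omega>) x y"
      by (rule conn_mono) auto
    ultimately show "\<omega> \<in> A T - (A T \<inter> C)" by (auto simp: A_def C_def P_def)
  qed
  then have "prob (A (Suc T)) \<le> prob (A T - (A T \<inter> C))"
    using Ae Ce by (intro finite_measure_mono) auto
  also have "\<dots> = prob (A T) - prob (A T \<inter> C)"
    using Ae Ce by (intro finite_measure_Diff) auto
  also have "\<dots> \<le> (1 - \<beta> ^ l) * prob (A T)" using AC by (simp add: algebra_simps)
  also have "\<dots> \<le> (1 - \<beta> ^ l) * (1 - \<beta> ^ l) ^ T"
  proof (rule mult_left_mono)
    show "prob (A T) \<le> (1 - \<beta> ^ l) ^ T" using Suc unfolding A_def P_def .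
    show "0 \<le> 1 - \<beta> ^ l" using \<beta> by (simp add: power_le_one)
  qed
  finally show ?case unfolding A_def P_def by simp
qed

text \<open>Outside an exceptional event, the powder keg puts all but \<open>\<eta> * real n\<close>
  of the starting vertices into linear-sized components during the first \<open>T\<close> steps. A
  union bound over vertex pairs shows that these components have merged into one after
  \<open>T\<close> more.\<close>

lemma giant_forms:
  assumes l: "l \<ge> 1" and eta: "0 < \<eta>" "\<eta> \<le> 1" and r: "r > 0" and mrg: "merging l n M F E"
  shows "\<exists>B\<in>events.
    prob B \<le> 2 powr (real n / r) * (1 - (\<eta> / 2) ^ l / 2) ^ T + real n ^ 2 * (1 - (\<eta> / (2 * real l)) ^ l) ^ T \<and>
    (\<forall>\<omega>\<in>space M - B. real (card (large n (G s \<omega>) r)) - \<eta> * real n \<le> real (L1 n (G (s + 2 * T) \<omega>)))"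
proof -
  define \<beta> where "\<beta> = \<eta> / (2 * real l)"
  have \<beta>: "0 < \<beta>" "\<beta> \<le> 1" using eta l by (auto simp: \<beta>_def field_simps)
  let ?L = "\<lambda>m \<omega>. large n (G m \<omega>) (\<beta> * real n)"
  define B1 where "B1 = {\<omega> \<in> space M. \<eta> * real n \<le> real (card (large n (G s \<omega>) r - ?L (s + T) \<omega>))}"
  define B2 where "B2 p = {\<omega> \<in> space M. fst p \<in> ?L (s + T) \<omega> \<and> snd p \<in> ?L (s + T) \<omega>
      \<and> \<not> conn (G (s + T + T) \<omega>) (fst p) (snd p)}" for p
  let ?I = "{..<n} \<times> {..<n}"
  have B1e: "B1 \<in> events" unfolding B1_def by (rule sets_F[OF G_event]) simp
  have B2e: "B2 p \<in> events" for p
    unfolding B2_def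
    by (rule sets_F, rule G_event[of "s + T" "s + T + T" "\<lambda>g h. fst p \<in> large n g (\<beta> * real n) \<and>
      snd p \<in> large n g (\<beta> * real n) \<and> \<not> conn h (fst p) (snd p)"]) simp
  have P1: "prob B1 \<le> 2 powr (real n / r) * (1 - (\<eta> / 2) ^ l / 2) ^ T"
    unfolding B1_def by (rule powder_keg[OF l eta r \<beta>_def])
  have "prob (\<Union>p\<in>?I. B2 p) \<le> (\<Sum>p\<in>?I. prob (B2 p))"
    using B2e by (intro finite_measure_subadditive_finite) auto
  also have "\<dots> \<le> (\<Sum>p\<in>?I. (1 - \<beta> ^ l) ^ T)"
    unfolding B2_def using merging_tail[OF mrg \<beta>, of _ _ "s + T" T] by (intro sum_mono) auto
  also have "\<dots> = real n ^ 2 * (1 - \<beta> ^ l) ^ T"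
    by (simp add: power2_eq_square)
  finally have P2: "prob (\<Union>p\<in>?I. B2 p) \<le> real n ^ 2 * (1 - \<beta> ^ l) ^ T" .
  have B2e': "(\<Union>p\<in>?I. B2 p) \<in> events" using B2e by (intro sets.finite_UN) auto
  show ?thesis
  proof (intro bexI conjI ballI)
    show "B1 \<union> (\<Union>p\<in>?I. B2 p) \<in> events" using B1e B2e' by (rule sets.Un)
    show "prob (B1 \<union> (\<Union>p\<in>?I. B2 p)) \<le> 2 powr (real n / r) * (1 - (\<eta> / 2) ^ l / 2) ^ T
        + real n ^ 2 * (1 - (\<eta> / (2 * real l)) ^ l) ^ T"
      using measure_Un_le[OF B1e B2e'] P1 P2 unfolding \<beta>_def by linarith
    fix \<omega> assume \<omega>: "\<omega> \<in> space M - (B1 \<union> (\<Union>p\<in>?I. B2 p))"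
    let ?W = "large n (G s \<omega>) r"
    have "conn (G (s + T + T) \<omega>) x y" if xy: "x \<in> ?L (s + T) \<omega>" "y \<in> ?L (s + T) \<omega>" for x y
    proof -
      have "(x, y) \<in> ?I" using xy by (auto simp: large_def)
      then have "\<omega> \<notin> B2 (x, y)" using \<omega> by blast
      then show ?thesis using \<omega> xy by (auto simp: B2_def)
    qed
    then have big: "card (?L (s + T) \<omega>) \<le> L1 n (G (s + T + T) \<omega>)" by (rule card_large_le_L1)
    have "\<omega> \<notin> B1" "\<omega> \<in> space M" using \<omega> by auto
    then have rest: "real (card (?W - ?L (s + T) \<omega>)) < \<eta> * real n" by (simp add: B1_def)
    have "card ?W \<le> card ((?W - ?L (s + T) \<omega>) \<union> ?L (s + T) \<omega>)" by (intro card_mono) auto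
    also have "\<dots> \<le> card (?W - ?L (s + T) \<omega>) + card (?L (s + T) \<omega>)" by (rule card_Un_le)
    finally show "real (card ?W) - \<eta> * real n \<le> real (L1 n (G (s + 2 * T) \<omega>))"
      using big rest by (simp add: mult_2 add.assoc)
  qed
qed

subsection \<open>Survival of small components\<close>

text \<open>The indices run from \<open>Suc s\<close> to \<open>s + T\<close>, the tuples used in
  passing from \<open>G s\<close> to \<open>G (s + T)\<close>. The set \<open>U\<close> is
  deterministic, so components are inserted after fixing the value of \<open>G s\<close>.\<close>

definition avoid :: "nat \<Rightarrow> nat \<Rightarrow> nat set \<Rightarrow> 'a set" where
  "avoid s T U = {\<omega> \<in> space M. \<forall>j<T. \<forall>i<l. v (Suc (s + j)) \<omega> i \<notin> U}"

lemma avoid_Un: "avoid s T U \<inter> avoid s T U' = avoid s T (U \<union> U')"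
  by (auto simp: avoid_def)

lemma avoid_Suc:
  "avoid s (Suc T) U = avoid s T U \<inter> {\<omega> \<in> space M. tup (Suc (s + T)) \<omega> \<in> {..<l} \<rightarrow>\<^sub>E ({..<n} - U)}"
proof -
  have "tup (Suc (s + T)) \<omega> \<in> {..<l} \<rightarrow>\<^sub>E ({..<n} - U) \<longleftrightarrow> (\<forall>i<l. v (Suc (s + T)) \<omega> i \<notin> U)"
    if "\<omega> \<in> space M" for \<omega>
    using v_less[OF _ that, of "Suc (s + T)"] unfolding tup_def restrict_PiE_iff by auto
  then show ?thesis by (auto simp: avoid_def less_Suc_eq)
qed

lemma avoid_event: "avoid s T U \<in> sets (F (s + T))"
proof (induction T)
  case 0
  have "space (F s) \<in> sets (F s)" by (rule sets.top)
  then show ?case by (simp add: avoid_def space_F)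
next
  case (Suc T)
  have "avoid s T U \<in> sets (F (Suc (s + T)))" by (rule sets_F_mono[OF _ Suc]) simp
  moreover have "{\<omega> \<in> space M. tup (Suc (s + T)) \<omega> \<in> {..<l} \<rightarrow>\<^sub>E ({..<n} - U)} \<in> sets (F (Suc (s + T)))"
    by (rule tup_event, rule PiE_mono) auto
  ultimately show ?case unfolding avoid_Suc add_Suc_right by (rule sets.Int)
qed

text \<open>Each tuple is independent of the past and misses \<open>U\<close> with probability
  \<open>(1 - real (card U) / real n) ^ l\<close>.\<close>

lemma prob_avoid:
  assumes A: "A \<in> sets (F s)" and U: "U \<subseteq> {..<n}"
  shows "prob (A \<inter> avoid s T U) = prob A * (1 - real (card U) / real n) ^ (l * T)"
proof (induction T)
  case 0
  have "A \<subseteq> space M" using sets.sets_into_space[OF A] by (simp add: space_F)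
  then have "A \<inter> avoid s 0 U = A" by (auto simp: avoid_def)
  then show ?case by simp
next
  case (Suc T)
  have fU: "finite U" using U finite_subset by blast
  have cU: "card U \<le> n" using card_mono[OF _ U] by simp
  have "A \<in> sets (F (s + T))" by (rule sets_F_mono[OF _ A]) simp
  then have AT: "A \<inter> avoid s T U \<in> sets (F (s + T))" using avoid_event by (rule sets.Int)
  have "card ({..<l} \<rightarrow>\<^sub>E ({..<n} - U)) = (n - card U) ^ l"
    using U fU by (subst card_PiE) (auto simp: card_Diff_subset)
  then have c: "real (card ({..<l} \<rightarrow>\<^sub>E ({..<n} - U))) / real n ^ l = (1 - real (card U) / real n) ^ l"
    using cU n_pos by (simp add: diff_divide_distrib flip: power_divide)
  have "A \<inter> avoid s (Suc T) U =
      (A \<inter> avoid s T U) \<inter> {\<omega> \<in> space M. tup (Suc (s + T)) \<omega> \<in> {..<l} \<rightarrow>\<^sub>E ({..<n} - U)}"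
    unfolding avoid_Suc by blast
  then have "prob (A \<inter> avoid s (Suc T) U) = prob (A \<inter> avoid s T U)
      * real (card ({..<l} \<rightarrow>\<^sub>E ({..<n} - U))) / real n ^ l"
    using prob_tup[OF AT, of "{..<l} \<rightarrow>\<^sub>E ({..<n} - U)"] by (simp add: PiE_mono)
  also have "\<dots> = prob (A \<inter> avoid s T U) * (1 - real (card U) / real n) ^ l"
    unfolding c[symmetric] by simp
  finally show ?case unfolding Suc by (simp add: power_add mult_ac)
qed

lemma avoid_comp:
  assumes "\<omega> \<in> avoid s T (comp n (G s \<omega>) x)" and "j \<le> T"
  shows "comp n (G (s + j) \<omega>) x = comp n (G s \<omega>) x"
  using assms(2)
proof (induction j)
  case (Suc j)
  then have IH: "comp n (G (s + j) \<omega>) x = comp n (G s \<omega>) x" by simp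
  have \<omega>: "\<omega> \<in> space M" using assms(1) by (simp add: avoid_def)
  have "comp n (G (s + j) \<omega> \<union> E (Suc (s + j)) \<omega>) x = comp n (G (s + j) \<omega>) x"
  proof (rule comp_Un_untouched)
    show "e \<subseteq> v (Suc (s + j)) \<omega> ` {..<l}" if "e \<in> E (Suc (s + j)) \<omega>" for e
      using E_subset[OF _ \<omega> that] by simp
    show "v (Suc (s + j)) \<omega> ` {..<l} \<subseteq> {..<n}" by (rule v_subset[OF _ \<omega>]) simp
    show "comp n (G (s + j) \<omega>) x \<inter> v (Suc (s + j)) \<omega> ` {..<l} = {}"
      unfolding IH using assms(1) Suc.prems by (auto simp: avoid_def)
  qed
  then show ?case using IH by simp
qed simp

text \<open>A variance bound restricted to \<open>A\<close>, which will fix the value of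
  \<open>G s\<close>. Avoiding two disjoint components is negatively correlated, because
  \<open>1 - u - w \<le> (1 - u) * (1 - w)\<close> for nonnegative \<open>u\<close> and
  \<open>w\<close>. Hence only pairs in a common component contribute, and each \<open>x\<close> has
  at most \<open>k\<close> partners.\<close>

lemma avoid_second_moment:
  assumes A: "A \<in> sets (F s)" and X: "X \<subseteq> {..<n}"
    and k0: "0 \<le> k" and k: "\<And>x. x \<in> X \<Longrightarrow> real (card (comp n g x)) \<le> k"
    and q: "\<And>x. q x = (1 - real (card (comp n g x)) / real n) ^ (l * T)"
  shows "(\<integral>\<omega>. indicator A \<omega> * ((\<Sum>x\<in>X. indicator (avoid s T (comp n g x)) \<omega>) - (\<Sum>x\<in>X. q x))\<^sup>2 \<partial>M)
      \<le> prob A * (real n * k)"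
proof -
  let ?I = "\<lambda>x. avoid s T (comp n g x)"
  let ?C = "comp n g"
  have finX: "finite X" using X finite_subset by blast
  have cn: "card (?C x) \<le> n" for x using card_mono[OF _ comp_subset[of n g x]] by simp
  have le1: "0 \<le> 1 - real (card (?C x)) / real n" "1 - real (card (?C x)) / real n \<le> 1" for x
    using cn[of x] n_pos by (auto simp: field_simps)
  have q01: "0 \<le> q x" "q x \<le> 1" for x
    unfolding q using le1[of x] by (auto intro: zero_le_power power_le_one)
  have Ae: "A \<in> events" using A by (rule sets_F)
  have Ie: "avoid s T U \<in> events" for U using avoid_event by (rule sets_F)
  have int: "integrable M (indicator B :: 'a \<Rightarrow> real)" if "B \<in> events" for B
    using that by (intro integrable_real_indicator) (auto simp: emeasure_eq_measure)
  \<comment> \<open>The product of two centred indicators, restricted to \<open>A\<close> and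
    multiplied out so that \<open>prob_avoid\<close> evaluates each term.\<close>
  let ?f = "\<lambda>x y \<omega>. indicator (A \<inter> avoid s T (?C x \<union> ?C y)) \<omega> - q y * indicator (A \<inter> ?I x) \<omega>
      - q x * indicator (A \<inter> ?I y) \<omega> + q x * q y * indicator A \<omega> :: real"
  have intf: "integrable M (?f x y)" for x y
    using Ae Ie by (intro Bochner_Integration.integrable_add Bochner_Integration.integrable_diff
      integrable_mult_right int sets.Int)
  have cov: "(\<integral>\<omega>. ?f x y \<omega> \<partial>M) \<le> prob A * (if y \<in> ?C x then 1 else 0)"
    if xy: "x \<in> X" "y \<in> X" for x y
  proof -
    let ?q = "(1 - real (card (?C x \<union> ?C y)) / real n) ^ (l * T)"
    have "(\<integral>\<omega>. ?f x y \<omega> \<partial>M) = prob (A \<inter> avoid s T (?C x \<union> ?C y)) - q y * prob (A \<inter> ?I x)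
      - q x * prob (A \<inter> ?I y) + q x * q y * prob A"
      using Ae Ie by (simp add: int)
    also have "\<dots> = prob A * (?q - q x * q y)"
    proof -
      have "prob (A \<inter> avoid s T (?C x \<union> ?C y)) = prob A * ?q"
        by (rule prob_avoid[OF A]) (use comp_subset in auto)
      moreover have "prob (A \<inter> ?I z) = prob A * q z" for z
        unfolding q by (rule prob_avoid[OF A comp_subset])
      ultimately show ?thesis by (simp add: algebra_simps)
    qed
    also have "\<dots> \<le> prob A * (if y \<in> ?C x then 1 else 0)"
    proof (rule mult_left_mono)
      show "?q - q x * q y \<le> (if y \<in> ?C x then 1 else 0)"
      proof (cases "y \<in> ?C x")
        case True
        have "card (?C x \<union> ?C y) \<le> n"
          using card_mono[of "{..<n}" "?C x \<union> ?C y"] comp_subset by auto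
        then have "?q \<le> 1" using n_pos by (intro power_le_one) (auto simp: field_simps)
        moreover have "0 \<le> q x * q y" using q01 by simp
        ultimately show ?thesis using True by simp
      next
        case False
        then have "\<not> conn g x y" using xy X by (auto simp: comp_def)
        then have dj: "?C x \<inter> ?C y = {}" by (rule comp_disjoint)
        then have card: "card (?C x \<union> ?C y) = card (?C x) + card (?C y)"
          by (intro card_Un_disjoint) auto
        have cle: "card (?C x \<union> ?C y) \<le> n"
          using card_mono[of "{..<n}" "?C x \<union> ?C y"] comp_subset by auto
        have "?q \<le> ((1 - real (card (?C x)) / real n) * (1 - real (card (?C y)) / real n)) ^ (l * T)"
        proof (rule power_mono)
          have "0 \<le> real (card (?C x)) / real n * (real (card (?C y)) / real n)" by simp
          then show "1 - real (card (?C x \<union> ?C y)) / real n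
              \<le> (1 - real (card (?C x)) / real n) * (1 - real (card (?C y)) / real n)"
            unfolding card by (simp add: algebra_simps add_divide_distrib)
          show "0 \<le> 1 - real (card (?C x \<union> ?C y)) / real n"
            using cle n_pos by (auto simp: field_simps)
        qed
        also have "\<dots> = q x * q y" unfolding q by (rule power_mult_distrib)
        finally show ?thesis using False by simp
      qed
    qed simp
    finally show ?thesis .
  qed
  have "(\<integral>\<omega>. indicator A \<omega> * ((\<Sum>x\<in>X. indicator (?I x) \<omega>) - (\<Sum>x\<in>X. q x))\<^sup>2 \<partial>M)
      = (\<integral>\<omega>. (\<Sum>x\<in>X. \<Sum>y\<in>X. ?f x y \<omega>) \<partial>M)"
  proof (rule Bochner_Integration.integral_cong[OF refl])
    fix \<omega>
    have "((\<Sum>x\<in>X. indicator (?I x) \<omega>) - (\<Sum>x\<in>X. q x))\<^sup>2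
        = (\<Sum>x\<in>X. \<Sum>y\<in>X. (indicator (?I x) \<omega> - q x) * (indicator (?I y) \<omega> - q y))"
      by (simp add: power2_eq_square sum_product flip: sum_subtractf)
    then have "indicator A \<omega> * ((\<Sum>x\<in>X. indicator (?I x) \<omega>) - (\<Sum>x\<in>X. q x))\<^sup>2
        = (\<Sum>x\<in>X. \<Sum>y\<in>X. indicator A \<omega> * ((indicator (?I x) \<omega> - q x) * (indicator (?I y) \<omega> - q y)))"
      by (simp only: sum_distrib_left)
    also have "\<dots> = (\<Sum>x\<in>X. \<Sum>y\<in>X. ?f x y \<omega>)"
      by (intro sum.cong refl) (simp add: avoid_Un[symmetric] indicator_inter_arith algebra_simps)
    finally show "indicator A \<omega> * ((\<Sum>x\<in>X. indicator (?I x) \<omega>) - (\<Sum>x\<in>X. q x))\<^sup>2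
        = (\<Sum>x\<in>X. \<Sum>y\<in>X. ?f x y \<omega>)" .
  qed
  also have "\<dots> = (\<Sum>x\<in>X. \<Sum>y\<in>X. \<integral>\<omega>. ?f x y \<omega> \<partial>M)"
  proof -
    have "(\<integral>\<omega>. (\<Sum>x\<in>X. \<Sum>y\<in>X. ?f x y \<omega>) \<partial>M) = (\<Sum>x\<in>X. \<integral>\<omega>. (\<Sum>y\<in>X. ?f x y \<omega>) \<partial>M)"
      by (rule Bochner_Integration.integral_sum, rule Bochner_Integration.integrable_sum, rule intf)
    also have "\<dots> = (\<Sum>x\<in>X. \<Sum>y\<in>X. \<integral>\<omega>. ?f x y \<omega> \<partial>M)"
      by (rule sum.cong[OF refl], rule Bochner_Integration.integral_sum, rule intf)
    finally show ?thesis .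
  qed
  also have "\<dots> \<le> (\<Sum>x\<in>X. \<Sum>y\<in>X. prob A * (if y \<in> ?C x then 1 else 0))"
    by (intro sum_mono cov)
  also have "\<dots> = prob A * (\<Sum>x\<in>X. real (card (X \<inter> ?C x)))"
  proof -
    have "(\<Sum>y\<in>X. if y \<in> ?C x then 1 else 0) = real (card (X \<inter> ?C x))" for x
      by (simp add: sum.inter_restrict[OF finX, symmetric])
    then show ?thesis by (simp only: sum_distrib_left[symmetric])
  qed
  also have "\<dots> \<le> prob A * (\<Sum>x\<in>X. k)"
  proof (intro mult_left_mono sum_mono)
    fix x assume "x \<in> X"
    have "real (card (X \<inter> ?C x)) \<le> real (card (?C x))" by (simp add: card_mono)
    then show "real (card (X \<inter> ?C x)) \<le> k" using k[OF \<open>x \<in> X\<close>] by linarith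
  qed simp
  also have "\<dots> \<le> prob A * (real n * k)"
    using card_mono[OF _ X] k0 by (auto intro!: mult_left_mono mult_right_mono)
  finally show ?thesis .
qed

text \<open>Chebyshev's inequality is applied on each event fixing \<open>G s\<close>, to the number
  of vertices of \<open>mid\<close> whose component is avoided throughout. Such vertices stay in
  \<open>mid\<close> at all intermediate times, so one exceptional event serves every
  \<open>m\<close>.\<close>

lemma survival:
  fixes k0 k \<epsilon> :: real
  assumes k: "0 \<le> k" "k \<le> real n" and eps: "\<epsilon> > 0"
  defines "mid \<equiv> \<lambda>g. large n g k0 - large n g k"
  shows "\<exists>B\<in>events. prob B \<le> k / (\<epsilon>\<^sup>2 * real n) \<and>
    (\<forall>\<omega>\<in>space M - B. \<forall>m. s \<le> m \<longrightarrow> m \<le> s + T \<longrightarrow>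
      (1 - k / real n) ^ (l * T) * real (card (mid (G s \<omega>))) - \<epsilon> * real n \<le> real (card (mid (G m \<omega>))))"
proof -
  define A where "A g = {\<omega> \<in> space M. G s \<omega> = g}" for g
  define q where "q g x = (1 - real (card (comp n g x)) / real n) ^ (l * T)" for g x
  define Y where "Y g \<omega> = (\<Sum>x\<in>mid g. indicator (avoid s T (comp n g x)) \<omega> :: real)" for g \<omega>
  define \<mu> where "\<mu> g = (\<Sum>x\<in>mid g. q g x)" for g
  define B where "B g = {\<omega> \<in> A g. Y g \<omega> < \<mu> g - \<epsilon> * real n}" for g
  have mid: "mid g \<subseteq> {..<n}" for g using large_subset[of n g k0] by (auto simp: mid_def)
  have midk: "real (card (comp n g x)) \<le> k" if "x \<in> mid g" for g x
    using that by (auto simp: mid_def large_def)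
  have AF: "A g \<in> sets (F s)" for g unfolding A_def by (rule G_event) simp
  have Ae: "A g \<in> events" for g using AF by (rule sets_F)
  have Ie: "avoid s T W \<in> events" for W using avoid_event by (rule sets_F)
  have Ym: "Y g \<in> borel_measurable M" for g
    unfolding Y_def using Ie by (intro borel_measurable_sum borel_measurable_indicator)
  have Be: "B g \<in> events" for g
  proof -
    have "{\<omega> \<in> space M. Y g \<omega> < \<mu> g - \<epsilon> * real n} \<in> events"
      using Ym by measurable
    then have "A g \<inter> {\<omega> \<in> space M. Y g \<omega> < \<mu> g - \<epsilon> * real n} \<in> events"
      by (rule sets.Int[OF Ae])
    also have "A g \<inter> {\<omega> \<in> space M. Y g \<omega> < \<mu> g - \<epsilon> * real n} = B g"
      unfolding B_def A_def by blast
    finally show ?thesis .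
  qed
  have n0: "0 < \<epsilon> * real n" using eps n_pos by simp
  have PB: "prob (B g) \<le> prob (A g) * (k / (\<epsilon>\<^sup>2 * real n))" for g
  proof -
    have Y0: "0 \<le> Y g \<omega>" "Y g \<omega> \<le> real (card (mid g))" for \<omega>
      unfolding Y_def by (auto intro!: sum_nonneg sum_bounded_above[where K = 1, simplified])
    have "(\<epsilon> * real n)\<^sup>2 * prob (B g) = (\<integral>\<omega>. (\<epsilon> * real n)\<^sup>2 * indicator (B g) \<omega> \<partial>M)"
      using Be by simp
    also have "\<dots> \<le> (\<integral>\<omega>. indicator (A g) \<omega> * (Y g \<omega> - \<mu> g)\<^sup>2 \<partial>M)"
    proof (rule integral_mono)
      show "integrable M (\<lambda>\<omega>. (\<epsilon> * real n)\<^sup>2 * indicator (B g) \<omega>)"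
        using Be by (intro integrable_mult_right integrable_real_indicator) (auto simp: emeasure_eq_measure)
      show "integrable M (\<lambda>\<omega>. indicator (A g) \<omega> * (Y g \<omega> - \<mu> g)\<^sup>2)"
      proof (rule integrable_const_bound)
        have "\<bar>Y g \<omega> - \<mu> g\<bar> \<le> real (card (mid g)) + \<bar>\<mu> g\<bar>" for \<omega>
          using Y0[of \<omega>] by linarith
        then have "(Y g \<omega> - \<mu> g)\<^sup>2 \<le> (real (card (mid g)) + \<bar>\<mu> g\<bar>)\<^sup>2" for \<omega>
          by (rule power2_le_iff_abs_le[THEN iffD2, rotated]) simp
        then have "norm (indicator (A g) \<omega> * (Y g \<omega> - \<mu> g)\<^sup>2) \<le> (real (card (mid g)) + \<bar>\<mu> g\<bar>)\<^sup>2" for \<omega>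
          by (simp add: indicator_def)
        then show "AE \<omega> in M. norm (indicator (A g) \<omega> * (Y g \<omega> - \<mu> g)\<^sup>2) \<le> (real (card (mid g)) + \<bar>\<mu> g\<bar>)\<^sup>2"
          by simp
        show "(\<lambda>\<omega>. indicator (A g) \<omega> * (Y g \<omega> - \<mu> g)\<^sup>2) \<in> borel_measurable M"
          using Ym Ae by measurable
      qed
      show "(\<epsilon> * real n)\<^sup>2 * indicator (B g) \<omega> \<le> indicator (A g) \<omega> * (Y g \<omega> - \<mu> g)\<^sup>2" for \<omega>
      proof (cases "\<omega> \<in> B g")
        case True
        then have "\<omega> \<in> A g" "\<epsilon> * real n \<le> \<bar>Y g \<omega> - \<mu> g\<bar>" by (auto simp: B_def)
        then show ?thesis using n0 True abs_le_square_iff[of "\<epsilon> * real n" "Y g \<omega> - \<mu> g"] by simp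
      qed (simp add: indicator_def)
    qed
    also have "\<dots> \<le> prob (A g) * (real n * k)"
      unfolding Y_def \<mu>_def by (rule avoid_second_moment[OF AF mid k(1) midk]) (simp_all add: q_def)
    finally show ?thesis using n0 n_pos eps by (simp add: field_simps power2_eq_square)
  qed
  have "prob (\<Union>g\<in>graphs. B g) \<le> (\<Sum>g\<in>graphs. prob (B g))"
    using Be by (intro finite_measure_subadditive_finite finite_graphs) auto
  also have "\<dots> \<le> (\<Sum>g\<in>graphs. prob (A g)) * (k / (\<epsilon>\<^sup>2 * real n))"
    unfolding sum_distrib_right by (rule sum_mono[OF PB])
  also have "(\<Sum>g\<in>graphs. prob (A g)) = prob (\<Union>g\<in>graphs. A g)"
    using Ae by (intro finite_measure_finite_Union[symmetric] finite_graphs)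
      (auto simp: disjoint_family_on_def A_def)
  also have "\<dots> * (k / (\<epsilon>\<^sup>2 * real n)) \<le> 1 * (k / (\<epsilon>\<^sup>2 * real n))"
    using k by (intro mult_right_mono) auto
  finally have P: "prob (\<Union>g\<in>graphs. B g) \<le> k / (\<epsilon>\<^sup>2 * real n)" by simp
  show ?thesis
  proof (intro bexI conjI ballI allI impI)
    show "(\<Union>g\<in>graphs. B g) \<in> events" using Be by (intro sets.finite_UN finite_graphs)
    show "prob (\<Union>g\<in>graphs. B g) \<le> k / (\<epsilon>\<^sup>2 * real n)" by (rule P)
    fix \<omega> m assume \<omega>B: "\<omega> \<in> space M - (\<Union>g\<in>graphs. B g)" and m: "s \<le> m" "m \<le> s + T"
    then have \<omega>: "\<omega> \<in> space M" by simp
    let ?g = "G s \<omega>"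
    have "?g \<in> graphs" using \<omega> by (rule G_graphs)
    then have "\<omega> \<notin> B ?g" using \<omega>B by blast
    then have Y: "\<mu> ?g - \<epsilon> * real n \<le> Y ?g \<omega>" using \<omega> by (simp add: B_def A_def)
    have "(1 - k / real n) ^ (l * T) * real (card (mid ?g)) = (\<Sum>x\<in>mid ?g. (1 - k / real n) ^ (l * T))"
      by simp
    also have "\<dots> \<le> \<mu> ?g"
      unfolding \<mu>_def q_def using k n_pos midk
      by (intro sum_mono power_mono) (auto simp: divide_right_mono)
    finally have \<mu>: "(1 - k / real n) ^ (l * T) * real (card (mid ?g)) \<le> \<mu> ?g" .
    have "Y ?g \<omega> = real (card {x \<in> mid ?g. \<omega> \<in> avoid s T (comp n ?g x)})"
      using finite_subset[OF mid] unfolding Y_def by (simp add: indicator_def Int_def flip: sum.inter_filter)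
    also have "\<dots> \<le> real (card (mid (G m \<omega>)))"
    proof -
      have "{x \<in> mid ?g. \<omega> \<in> avoid s T (comp n ?g x)} \<subseteq> mid (G m \<omega>)"
      proof
        fix x assume "x \<in> {x \<in> mid ?g. \<omega> \<in> avoid s T (comp n ?g x)}"
        then have x: "x \<in> mid ?g" "\<omega> \<in> avoid s T (comp n ?g x)" by auto
        have "comp n (G m \<omega>) x = comp n ?g x"
          using avoid_comp[OF x(2), of "m - s"] m by simp
        then show "x \<in> mid (G m \<omega>)" using x(1) by (simp add: mid_def large_def)
      qed
      then show ?thesis using finite_subset[OF mid] by (simp add: card_mono)
    qed
    finally show "(1 - k / real n) ^ (l * T) * real (card (mid ?g)) - \<epsilon> * real n \<le> real (card (mid (G m \<omega>)))"
      using Y \<mu> by linarith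
  qed
qed

subsection \<open>Jumps are unlikely\<close>

lemma card_large_growth:
  assumes "\<omega> \<in> space M" and "r \<ge> 0" and "s \<le> m"
  shows "real (card (large n (G m \<omega>) r)) \<le> real (card (large n (G s \<omega>) r)) + real l * r * (real m - real s)"
  using assms(3)
proof (induction rule: dec_induct)
  case (step m)
  let ?V = "v (Suc m) \<omega> ` {..<l}"
  have "real (card (large n (G m \<omega> \<union> E (Suc m) \<omega>) r)) \<le> real (card (large n (G m \<omega>) r)) + real l * r"
  proof (rule card_large_Un)
    show "e \<subseteq> ?V" if "e \<in> E (Suc m) \<omega>" for e
      using E_subset[OF _ assms(1) that] by simp
    show "?V \<subseteq> {..<n}" by (rule v_subset[OF _ assms(1)]) simp
    show "card ?V \<le> l" using card_image_le[of "{..<l}" "v (Suc m) \<omega>"] by simp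
  qed (rule assms(2))
  then show ?case using step.IH by (simp add: algebra_simps)
qed simp

text \<open>Over \<open>2 * q j\<close> steps the count at scale \<open>K j\<close> grows by at most
  \<open>\<eta> * real n\<close>, and \<open>c\<close> bounds below the survival probability of a
  component of size \<open>K (Suc j)\<close>. A giant exists by time \<open>2 * (Q * n)\<close> up
  to a small failure probability, and \<open>I\<close> starting times on a grid of mesh
  \<open>q j\<close> suffice until then. The gap \<open>5 * \<eta>\<close> pays for four losses of
  \<open>\<eta>\<close> and leaves a strict inequality.\<close>

lemma prob_jump_le:
  fixes A J Q I :: nat and a b \<eta> h :: real
  defines "K \<equiv> \<lambda>j. real (A ^ Suc j)"
    and "q \<equiv> \<lambda>j. nat \<lfloor>\<eta> * real n / (2 * real l * real (A ^ Suc j))\<rfloor>"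
    and "c \<equiv> exp (- 2 * real A * \<eta>)"
  defines "\<epsilon> \<equiv> c * \<eta> / 2"
  assumes l: "l \<ge> 1" and mrg: "merging l n M F E" and eta: "0 < \<eta>" "\<eta> \<le> 1" and A: "A \<ge> 2"
    and ab: "b - a = 5 * \<eta>" "0 \<le> a" "b \<le> 1"
    and J: "real J * \<epsilon> \<ge> 1"
    and h: "real l * K J * h \<le> \<eta> * real n"
    and KJ: "K J \<le> b * real n" "K J \<le> real n / 2"
    and q: "\<And>j. j < J \<Longrightarrow> 1 \<le> q j" "\<And>j. j < J \<Longrightarrow> 2 * (Q * n) \<le> I * q j"
  shows "prob {\<omega> \<in> space M. \<exists>m1 m2. real (L1 n (G m1 \<omega>)) \<le> a * real n \<and>
            real (L1 n (G m2 \<omega>)) \<ge> b * real n \<and> real m2 \<le> real m1 + h}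
    \<le> tail l \<eta> n 1 (Q * n) +
      (\<Sum>j<J. real I * (tail l \<eta> n (K (Suc j)) (q j div 2) + K (Suc j) / (\<epsilon>\<^sup>2 * real n)))"
    (is "prob ?E \<le> _")
proof -
  have Kpos: "K j > 0" for j using A by (simp add: K_def)
  have Kmono: "K i \<le> K j" if "i \<le> j" for i j
    unfolding K_def of_nat_le_iff using A that by (intro power_increasing) auto
  have K1: "K j > 1" for j
    unfolding K_def using A one_less_power[of A "Suc j"] by (simp del: power_Suc)
  have eps: "\<epsilon> > 0" using eta by (simp add: \<epsilon>_def c_def)
  have qle: "2 * real l * K j * real (q j) \<le> \<eta> * real n" for j
  proof -
    have "real (q j) \<le> \<eta> * real n / (2 * real l * K j)"
      unfolding q_def K_def using eta by (intro of_nat_floor) (auto intro!: divide_nonneg_nonneg)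
    then show ?thesis using l Kpos[of j] by (simp add: field_simps)
  qed
  \<comment> \<open>Neighbouring scales differ by the factor \<open>A\<close>, so exponent times
    \<open>?x\<close> is at most \<open>real A * \<eta>\<close>, uniformly in \<open>j\<close> and
    \<open>n\<close>.\<close>
  have surv: "c \<le> (1 - K (Suc j) / real n) ^ (l * (2 * q j))" if "j < J" for j
  proof -
    let ?x = "K (Suc j) / real n"
    have x: "0 \<le> ?x" "?x \<le> 1 / 2"
      using Kmono[of "Suc j" J] Kpos[of "Suc j"] that KJ(2) n_pos by (auto simp: field_simps)
    have "real (l * (2 * q j)) * ?x = real A * (2 * real l * K j * real (q j)) / real n"
      by (simp add: K_def)
    also have "\<dots> \<le> real A * (\<eta> * real n) / real n"
      by (intro divide_right_mono mult_left_mono qle) auto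
    also have "\<dots> = real A * \<eta>" using n_pos by simp
    finally have "- 2 * real A * \<eta> \<le> real (l * (2 * q j)) * (- 2 * ?x)" by linarith
    then have "c \<le> exp (real (l * (2 * q j)) * (- 2 * ?x))" unfolding c_def by simp
    also have "\<dots> = exp (- 2 * ?x) ^ (l * (2 * q j))" by (rule exp_of_nat_mult)
    also have "\<dots> \<le> (1 - ?x) ^ (l * (2 * q j))"
      by (intro power_mono exp_le_one_minus x) simp
    finally show ?thesis .
  qed
  \<comment> \<open>With threshold \<open>1\<close> at time \<open>0\<close> every vertex counts, so
    a giant of at least \<open>(1 - \<eta>) * real n\<close> vertices exists by time
    \<open>2 * (Q * n)\<close> outside \<open>B0\<close>. This will bound \<open>m1\<close>.\<close>
  obtain B0 where B0: "B0 \<in> events" "prob B0 \<le> tail l \<eta> n 1 (Q * n)"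
    and B0': "\<And>\<omega>. \<omega> \<in> space M - B0 \<Longrightarrow>
      real (card (large n (G 0 \<omega>) 1)) - \<eta> * real n \<le> real (L1 n (G (0 + 2 * (Q * n)) \<omega>))"
    using giant_forms[OF l eta zero_less_one mrg, of "Q * n" 0] unfolding tail_def by blast
  \<comment> \<open>Two phases of \<open>q j div 2\<close> steps fit together into
    \<open>q j\<close> steps.\<close>
  define RA where "RA i j B \<longleftrightarrow> B \<in> events \<and> prob B \<le> tail l \<eta> n (K (Suc j)) (q j div 2) \<and>
      (\<forall>\<omega>\<in>space M - B. real (card (large n (G (i * q j) \<omega>) (K (Suc j)))) - \<eta> * real n
        \<le> real (L1 n (G (i * q j + 2 * (q j div 2)) \<omega>)))" for i j B
  have "\<exists>B. RA i j B" for i j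
    using giant_forms[OF l eta Kpos[of "Suc j"] mrg, of "q j div 2" "i * q j"]
    unfolding tail_def RA_def Bex_def .
  then obtain BA where RA: "\<And>i j. RA i j (BA i j)" by metis
  have BA: "BA i j \<in> events" "prob (BA i j) \<le> tail l \<eta> n (K (Suc j)) (q j div 2)"
    and BA': "\<omega> \<in> space M - BA i j \<Longrightarrow>
      real (card (large n (G (i * q j) \<omega>) (K (Suc j)))) - \<eta> * real n
        \<le> real (L1 n (G (i * q j + 2 * (q j div 2)) \<omega>))" for i j \<omega>
    using RA[of i j] unfolding RA_def by auto
  let ?mid = "\<lambda>j m \<omega>. real (card (large n (G m \<omega>) (K j) - large n (G m \<omega>) (K (Suc j))))"
  define RB where "RB i j B \<longleftrightarrow> B \<in> events \<and> prob B \<le> K (Suc j) / (\<epsilon>\<^sup>2 * real n) \<and>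
      (\<forall>\<omega>\<in>space M - B. \<forall>m. i * q j \<le> m \<longrightarrow> m \<le> i * q j + 2 * q j \<longrightarrow>
        (1 - K (Suc j) / real n) ^ (l * (2 * q j)) * ?mid j (i * q j) \<omega> - \<epsilon> * real n \<le> ?mid j m \<omega>)"
    for i j B
  have exB: "\<exists>B. RB i j B" if "j < J" for i j
  proof -
    have "0 \<le> K (Suc j)" using Kpos[of "Suc j"] by simp
    moreover have "K (Suc j) \<le> real n" using Kmono[of "Suc j" J] that KJ(2) by simp
    ultimately show ?thesis
      unfolding RB_def using survival[OF _ _ eps, of "K (Suc j)" "i * q j" "2 * q j" "K j"] by blast
  qed
  \<comment> \<open>\<open>SOME\<close> is applied because existence was shown only for
    \<open>j < J\<close>.\<close>
  define BB where "BB i j = (SOME B. RB i j B)" for i j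
  have RB: "RB i j (BB i j)" if "j < J" for i j
    unfolding BB_def by (rule someI_ex[OF exB[OF that]])
  have BB: "j < J \<Longrightarrow> BB i j \<in> events" "j < J \<Longrightarrow> prob (BB i j) \<le> K (Suc j) / (\<epsilon>\<^sup>2 * real n)"
    and BB': "j < J \<Longrightarrow> \<omega> \<in> space M - BB i j \<Longrightarrow> i * q j \<le> m \<Longrightarrow> m \<le> i * q j + 2 * q j \<Longrightarrow>
        (1 - K (Suc j) / real n) ^ (l * (2 * q j)) * ?mid j (i * q j) \<omega> - \<epsilon> * real n \<le> ?mid j m \<omega>"
    for i j \<omega> m
    using RB[of j i] unfolding RB_def by auto
  define B where "B = B0 \<union> (\<Union>j<J. \<Union>i<I. BA i j \<union> BB i j)"
  have ABe: "BA i j \<union> BB i j \<in> events" if "j < J" for i j using BA BB that by (intro sets.Un)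
  have UIe: "(\<Union>i<I. BA i j \<union> BB i j) \<in> events" if "j < J" for j
    using ABe[OF that] by (intro sets.finite_UN) auto
  have UJe: "(\<Union>j<J. \<Union>i<I. BA i j \<union> BB i j) \<in> events"
  proof (rule sets.finite_UN)
    show "(\<Union>i<I. BA i j \<union> BB i j) \<in> events" if "j \<in> {..<J}" for j using UIe that by blast
  qed simp
  have Be: "B \<in> events" unfolding B_def using B0(1) UJe by (rule sets.Un)
  have "prob (\<Union>j<J. \<Union>i<I. BA i j \<union> BB i j) \<le> (\<Sum>j<J. prob (\<Union>i<I. BA i j \<union> BB i j))"
    using UIe by (intro finite_measure_subadditive_finite) auto
  also have "\<dots> \<le> (\<Sum>j<J. real I * (tail l \<eta> n (K (Suc j)) (q j div 2) + K (Suc j) / (\<epsilon>\<^sup>2 * real n)))"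
  proof (rule sum_mono)
    fix j assume "j \<in> {..<J}"
    then have j: "j < J" by simp
    have "prob (\<Union>i<I. BA i j \<union> BB i j) \<le> (\<Sum>i<I. prob (BA i j \<union> BB i j))"
      using ABe[OF j] by (intro finite_measure_subadditive_finite) auto
    also have "\<dots> \<le> (\<Sum>i<I. tail l \<eta> n (K (Suc j)) (q j div 2) + K (Suc j) / (\<epsilon>\<^sup>2 * real n))"
    proof (rule sum_mono)
      fix i
      show "prob (BA i j \<union> BB i j) \<le> tail l \<eta> n (K (Suc j)) (q j div 2) + K (Suc j) / (\<epsilon>\<^sup>2 * real n)"
        using measure_Un_le[OF BA(1)[of i j] BB(1)[OF j, of i]] BA(2)[of i j] BB(2)[OF j, of i] by linarith
    qed
    finally show "prob (\<Union>i<I. BA i j \<union> BB i j) \<le>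
        real I * (tail l \<eta> n (K (Suc j)) (q j div 2) + K (Suc j) / (\<epsilon>\<^sup>2 * real n))" by simp
  qed
  finally have PB: "prob B \<le> tail l \<eta> n 1 (Q * n) +
      (\<Sum>j<J. real I * (tail l \<eta> n (K (Suc j)) (q j div 2) + K (Suc j) / (\<epsilon>\<^sup>2 * real n)))"
    using measure_Un_le[OF B0(1) UJe] B0(2) unfolding B_def by linarith
  have "?E \<subseteq> B"
  proof (rule ccontr)
    assume "\<not> ?E \<subseteq> B"
    then obtain \<omega> m1 m2 where \<omega>: "\<omega> \<in> space M" "\<omega> \<notin> B"
      and m1: "real (L1 n (G m1 \<omega>)) \<le> a * real n" and m2: "real (L1 n (G m2 \<omega>)) \<ge> b * real n"
      and m12: "real m2 \<le> real m1 + h"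
      by blast
    have nr: "real n \<ge> 1" using n_pos by simp
    have \<eta>n: "\<eta> * real n > 0" using eta nr by simp
    have an: "a * real n = b * real n - 5 * (\<eta> * real n)" using ab(1) by (simp add: algebra_simps flip: ab(1))
    have L1m: "real (L1 n (G i \<omega>)) \<le> real (L1 n (G j \<omega>))" if "i \<le> j" for i j
      using L1_mono[OF G_mono[OF that]] by simp
    have "m1 < m2"
    proof (rule ccontr)
      assume "\<not> m1 < m2"
      then have "real (L1 n (G m2 \<omega>)) \<le> real (L1 n (G m1 \<omega>))" by (intro L1m) simp
      then show False using m1 m2 an \<eta>n by linarith
    qed
    have "m1 < 2 * (Q * n)"
    proof (rule ccontr)
      assume "\<not> m1 < 2 * (Q * n)"
      then have "real (L1 n (G (2 * (Q * n)) \<omega>)) \<le> real (L1 n (G m1 \<omega>))" by (intro L1m) simp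
      moreover have "real n - \<eta> * real n \<le> real (L1 n (G (2 * (Q * n)) \<omega>))"
        using B0'[of \<omega>] \<omega> by (simp add: large_1 B_def)
      moreover have "b * real n \<le> 1 * real n" using ab(3) by (intro mult_right_mono) auto
      ultimately show False using m1 an \<eta>n by linarith
    qed
    define N where "N j m = real (card (large n (G m \<omega>) (K j)))" for j m
    have midN: "?mid j m \<omega> = N j m - N (Suc j) m" for j m
    proof -
      have sub: "large n (G m \<omega>) (K (Suc j)) \<subseteq> large n (G m \<omega>) (K j)"
        by (rule large_antimono[OF Kmono]) simp
      then show ?thesis
        unfolding N_def using card_mono[OF _ sub] by (simp add: card_Diff_subset)
    qed
    \<comment> \<open>At time \<open>m2\<close> the largest component alone contributes
      \<open>b * real n\<close>. Going back to \<open>m1\<close> over at most \<open>h\<close> steps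
      costs at most \<open>\<eta> * real n\<close> at every scale up to \<open>J\<close>.\<close>
    have Nm1: "b * real n - \<eta> * real n \<le> N j m1" if "j \<le> J" for j
    proof -
      have "K j \<le> real (L1 n (G m2 \<omega>))" using Kmono[OF that] KJ(1) m2 by linarith
      then have "real (L1 n (G m2 \<omega>)) \<le> N j m2"
        unfolding N_def using L1_le_card_large[OF n_pos] by simp
      moreover have "N j m2 \<le> N j m1 + real l * K j * (real m2 - real m1)"
        unfolding N_def using \<open>m1 < m2\<close> Kpos[of j] by (intro card_large_growth[OF \<omega>(1)]) auto
      moreover have "real l * K j * (real m2 - real m1) \<le> real l * K J * h"
      proof (rule mult_mono)
        show "real l * K j \<le> real l * K J" using Kmono[OF that] by (rule mult_left_mono) simp
      qed (use m12 \<open>m1 < m2\<close> Kpos[of J] in auto)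
      ultimately show ?thesis using h m2 by linarith
    qed
    \<comment> \<open>Pigeonhole: the \<open>J\<close> differences telescope to at most
      \<open>real n\<close>, while \<open>real J * \<epsilon> \<ge> 1\<close>.\<close>
    have "\<exists>j<J. N j m1 - N (Suc j) m1 \<le> \<epsilon> * real n"
    proof (rule ccontr)
      assume "\<not> ?thesis"
      then have gt: "N j m1 - N (Suc j) m1 > \<epsilon> * real n" if "j < J" for j using that by force
      have "J > 0" using J by (cases J) auto
      then have "(\<Sum>j<J. \<epsilon> * real n) < (\<Sum>j<J. N j m1 - N (Suc j) m1)"
        by (intro sum_strict_mono) (use gt in auto)
      also have "\<dots> = N 0 m1 - N J m1" by (rule sum_lessThan_telescope')
      also have "\<dots> \<le> real n" unfolding N_def using card_large_le[of n "G m1 \<omega>" "K 0"] by linarith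
      finally have "real J * \<epsilon> * real n < 1 * real n" by simp
      then show False using mult_right_mono[OF J, of "real n"] by simp
    qed
    then obtain j where j: "j < J" "N j m1 - N (Suc j) m1 \<le> \<epsilon> * real n" by blast
    \<comment> \<open>Rounding \<open>m1 - q j\<close> to a grid leaves only boundedly many starting times \<open>s\<close> in the union bound.\<close>
    define i where "i = m1 div q j - 1"
    define s where "s = i * q j"
    have qpos: "q j > 0" using q(1)[OF j(1)] by simp
    have m1q: "m1 = m1 div q j * q j + m1 mod q j" by (rule div_mult_mod_eq[symmetric])
    have m1s: "s \<le> m1" "m1 \<le> s + 2 * q j"
    proof -
      show "s \<le> m1" unfolding s_def i_def
        by (metis diff_le_self div_times_less_eq_dividend le_trans mult_le_mono1)
      show "m1 \<le> s + 2 * q j"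
        using m1q mod_less_divisor[OF qpos, of m1] unfolding s_def i_def
        by (cases "m1 div q j") auto
    qed
    have "N j m1 \<le> N j s + real l * K j * (real m1 - real s)"
      unfolding N_def using m1s Kpos[of j] by (intro card_large_growth[OF \<omega>(1)]) auto
    also have "\<dots> \<le> N j s + real l * K j * (2 * real (q j))"
      using m1s Kpos[of j] by (intro add_left_mono mult_left_mono) auto
    also have "\<dots> \<le> N j s + \<eta> * real n" using qle[of j] by (simp add: mult_ac)
    finally have Ns: "b * real n - 2 * (\<eta> * real n) \<le> N j s"
      using Nm1[of j] j(1) by linarith
    \<comment> \<open>If the quotient were \<open>0\<close>, truncated subtraction would give
      \<open>s = 0\<close>, where the empty graph has no component of size \<open>K j > 1\<close>.
      Excluding this yields \<open>s + q j \<le> m1\<close>, the time the powder keg needs.\<close>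
    have "m1 div q j \<noteq> 0"
    proof
      assume "m1 div q j = 0"
      then have "N j s = 0" unfolding N_def s_def i_def by (simp add: large_empty[OF K1])
      moreover have "0 \<le> a * real n" using ab(2) by simp
      ultimately show False using Ns an \<eta>n by linarith
    qed
    then have sq: "s + q j \<le> m1"
      using m1q unfolding s_def i_def by (cases "m1 div q j") auto
    have "m1 < I * q j" using \<open>m1 < 2 * (Q * n)\<close> q(2)[OF j(1)] by linarith
    then have "i < I" unfolding i_def using \<open>m1 div q j \<noteq> 0\<close> less_mult_imp_div_less by fastforce
    then have nB: "\<omega> \<in> space M - BA i j" "\<omega> \<in> space M - BB i j" using \<omega> j(1) by (auto simp: B_def)
    have Nd: "0 \<le> N j s - N (Suc j) s" unfolding midN[symmetric] by simp
    \<comment> \<open>Few middle-sized vertices at \<open>m1\<close> force few at \<open>s\<close>,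
      since at least a fraction \<open>c\<close> of them survives up to the error
      \<open>\<epsilon> * real n\<close>. The choice \<open>\<epsilon> = c * \<eta> / 2\<close>
      turns both errors together into one loss of \<open>\<eta> * real n\<close>.\<close>
    have "c * (N j s - N (Suc j) s) \<le> (1 - K (Suc j) / real n) ^ (l * (2 * q j)) * (N j s - N (Suc j) s)"
      by (rule mult_right_mono[OF surv[OF j(1)] Nd])
    also have "\<dots> \<le> 2 * (\<epsilon> * real n)"
      using BB'[OF j(1) nB(2), of m1] m1s j(2) unfolding midN s_def[symmetric] by linarith
    also have "\<dots> = c * (\<eta> * real n)" by (simp add: \<epsilon>_def)
    finally have "N j s - N (Suc j) s \<le> \<eta> * real n" by (simp add: c_def)
    \<comment> \<open>The four losses come from the window \<open>h\<close>, the step back from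
      \<open>m1\<close> to \<open>s\<close>, the middle-sized vertices and the powder keg.\<close>
    then have "b * real n - 4 * (\<eta> * real n) \<le> real (L1 n (G (s + 2 * (q j div 2)) \<omega>))"
      using BA'[OF nB(1)] Ns unfolding N_def s_def by linarith
    also have "\<dots> \<le> real (L1 n (G m1 \<omega>))" using sq by (intro L1m) linarith
    finally show False using m1 an \<eta>n by linarith
  qed
  then have "prob ?E \<le> prob B" using Be by (rule finite_measure_mono)
  then show ?thesis using PB by linarith
qed

end

section \<open>Choice of the constants and passage to the limit\<close>

theorem theorem4:
  fixes l :: nat
    and M :: "nat \<Rightarrow> 'a measure"
    and F :: "nat \<Rightarrow> nat \<Rightarrow> 'a measure"
    and v :: "nat \<Rightarrow> nat \<Rightarrow> 'a \<Rightarrow> nat \<Rightarrow> nat"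
    and E :: "nat \<Rightarrow> nat \<Rightarrow> 'a \<Rightarrow> nat set set"
    and h :: "nat \<Rightarrow> real"
    and a b :: real
  assumes "l \<ge> 2"
    and "\<And>n. n \<ge> 1 \<Longrightarrow> l_vertex_rule l n (M n) (F n) (v n) (E n)"
    and "\<And>n. n \<ge> 1 \<Longrightarrow> merging l n (M n) (F n) (E n)"
    and "h \<in> o(\<lambda>n. real n)"
    and "0 \<le> a" and "a < b"
  shows "(\<lambda>n. measure (M n) {\<omega> \<in> space (M n). \<exists>m1 m2.
            real (L1 n (rgraph (E n) m1 \<omega>)) \<le> a * real n \<and>
            real (L1 n (rgraph (E n) m2 \<omega>)) \<ge> b * real n \<and>
            real m2 \<le> real m1 + h n}) \<longlonglongrightarrow> 0"
proof (cases "b \<le> 1")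
  \<comment> \<open>No component exceeds \<open>n\<close> vertices, so for \<open>b > 1\<close> the
    event is empty.\<close>
  case False
  have "measure (M n) {\<omega> \<in> space (M n). \<exists>m1 m2. real (L1 n (rgraph (E n) m1 \<omega>)) \<le> a * real n \<and>
      real (L1 n (rgraph (E n) m2 \<omega>)) \<ge> b * real n \<and> real m2 \<le> real m1 + h n} = 0" if n: "n \<ge> 1" for n
  proof -
    have "real (L1 n g) < b * real n" for g
    proof -
      obtain x where "card (comp n g x) = L1 n g" using L1_attained[OF n] by blast
      then have "L1 n g \<le> n" using card_mono[OF _ comp_subset[of n g x]] by simp
      moreover have "1 * real n < b * real n" using False n by (intro mult_strict_right_mono) auto
      ultimately show ?thesis by linarith
    qed
    then show ?thesis by (simp add: not_le[symmetric])
  qed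
  then show ?thesis
    by (intro tendsto_eventually eventually_mono[OF eventually_ge_at_top[of 1]])
next
  case True
  define \<eta> where "\<eta> = (b - a) / 5"
  have eta: "0 < \<eta>" "\<eta> \<le> 1" and ab: "b - a = 5 * \<eta>" using assms(5,6) True by (auto simp: \<eta>_def)
  define p where "p = (\<eta> / 2) ^ l"
  have p: "p > 0" using eta by (simp add: p_def)
  have l: "l \<ge> 1" using assms(1) by simp
  \<comment> \<open>The powder keg at scale \<open>Suc j\<close> needs
    \<open>1 / K (Suc j) < p / 2 * (\<delta> j / 2)\<close>. Since
    \<open>\<delta> j = \<eta> / (2 * real l * K j)\<close>, this amounts to
    \<open>real A > 8 * real l / (p * \<eta>)\<close>, the same for every \<open>j\<close>.\<close>
  obtain A0 where A0: "8 * real l / (p * \<eta>) < real A0" using reals_Archimedean2 by blast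
  define A where "A = max 2 A0"
  have A: "A \<ge> 2" "8 * real l / (p * \<eta>) < real A" using A0 by (auto simp: A_def)
  define c where "c = exp (- 2 * real A * \<eta>)"
  define \<epsilon> where "\<epsilon> = c * \<eta> / 2"
  have eps: "\<epsilon> > 0" using eta by (simp add: \<epsilon>_def c_def)
  obtain J where "1 / \<epsilon> < real J" using reals_Archimedean2 by blast
  then have J: "real J * \<epsilon> \<ge> 1" using eps by (simp add: field_simps)
  \<comment> \<open>At threshold \<open>1\<close> the potential starts at up to
    \<open>2 powr real n\<close>; \<open>Q * n\<close> steps beat it when
    \<open>1 < p / 2 * real Q\<close>.\<close>
  obtain Q where "2 / p < real Q" using reals_Archimedean2 by blast
  then have Q: "1 < p / 2 * real Q" using p by (simp add: field_simps)
  define K where "K j = real (A ^ Suc j)" for j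
  define \<delta> where "\<delta> j = \<eta> / (2 * real l * K j)" for j
  define q where "q n j = nat \<lfloor>\<eta> * real n / (2 * real l * real (A ^ Suc j))\<rfloor>" for n j
  have Kpos: "K j > 0" for j using A by (simp add: K_def)
  have \<delta>: "\<delta> j > 0" for j using eta l Kpos[of j] by (simp add: \<delta>_def)
  have q\<delta>: "q n j = nat \<lfloor>\<delta> j * real n\<rfloor>" for n j by (simp add: q_def \<delta>_def K_def)
  have qge: "\<delta> j * real n - 1 \<le> real (q n j)" for n j unfolding q\<delta> by linarith
  have \<delta>J: "\<delta> J \<le> \<delta> j" if "j < J" for j
  proof -
    have "K j \<le> K J" unfolding K_def of_nat_le_iff using A that by (intro power_increasing) auto
    then show ?thesis unfolding \<delta>_def using eta l Kpos[of j] Kpos[of J]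
      by (intro divide_left_mono mult_left_mono mult_pos_pos) auto
  qed
  \<comment> \<open>Among the relevant scales \<open>\<delta> J\<close> is the smallest rate, and
    \<open>q n j \<ge> \<delta> J * real n / 2\<close> for large \<open>n\<close>; hence this
    \<open>I\<close> gives \<open>2 * (Q * n) \<le> I * q n j\<close> for all
    \<open>j < J\<close>.\<close>
  obtain I where I: "4 * real Q / \<delta> J < real I" using reals_Archimedean2 by blast
  define bound where "bound n = tail l \<eta> n 1 (Q * n) +
      (\<Sum>j<J. real I * (tail l \<eta> n (K (Suc j)) (q n j div 2) + K (Suc j) / (\<epsilon>\<^sup>2 * real n)))" for n
  \<comment> \<open>\<open>I\<close> and \<open>J\<close> are independent of \<open>n\<close>, so a
    finite sum of null sequences remains.\<close>
  have "bound \<longlonglongrightarrow> 0 + (\<Sum>j<J. real I * (0 + 0))"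
    unfolding bound_def
  proof (intro tendsto_add tendsto_sum tendsto_mult tendsto_const)
    have "real Q > 0" using Q p by (cases Q) auto
    then show "(\<lambda>n. tail l \<eta> n 1 (Q * n)) \<longlonglongrightarrow> 0"
      using Q unfolding p_def by (intro tail_tendsto_0[OF l eta, where x = "real Q"]) auto
    fix j
    show "(\<lambda>n. tail l \<eta> n (K (Suc j)) (q n j div 2)) \<longlonglongrightarrow> 0"
    proof (rule tail_tendsto_0[OF l eta, where x = "\<delta> j / 2"])
      show "\<delta> j / 2 > 0" using \<delta> by simp
      show "\<delta> j / 2 * real n - 1 \<le> real (q n j div 2)" for n
        using qge[of j n] by linarith
      show "K (Suc j) > 0" by (rule Kpos)
      have "8 * real l < p * \<eta> * real A" using A(2) p eta by (simp add: field_simps)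
      then have "8 * real l * K j < p * \<eta> * real A * K j" using Kpos[of j] by simp
      then show "1 / K (Suc j) < (\<eta> / 2) ^ l / 2 * (\<delta> j / 2)"
        unfolding \<delta>_def p_def[symmetric] using Kpos[of j] l A(1) by (simp add: K_def field_simps)
    qed
    show "(\<lambda>n. K (Suc j) / (\<epsilon>\<^sup>2 * real n)) \<longlonglongrightarrow> 0"
      using eps by real_asymp
  qed
  then have lim: "bound \<longlonglongrightarrow> 0" by simp
  have ev_h: "\<forall>\<^sub>F n in sequentially. real l * K J * h n \<le> \<eta> * real n"
  proof -
    have "0 < \<eta> / (real l * K J)" using eta l Kpos[of J] by simp
    from landau_o.smallD[OF assms(4) this] show ?thesis
    proof eventually_elim
      case (elim n)
      then have "h n \<le> \<eta> / (real l * K J) * real n" by simp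
      then have "real l * K J * h n \<le> real l * K J * (\<eta> / (real l * K J) * real n)"
        using Kpos[of J] by (intro mult_left_mono) auto
      then show ?case using l Kpos[of J] by simp
    qed
  qed
  have ev_n: "\<forall>\<^sub>F n in sequentially. x \<le> real n" for x
    by (rule eventually_compose_filterlim[OF eventually_ge_at_top filterlim_real_sequentially])
  have b: "b > 0" using assms by simp
  have "\<forall>\<^sub>F n in sequentially. measure (M n) {\<omega> \<in> space (M n). \<exists>m1 m2.
            real (L1 n (rgraph (E n) m1 \<omega>)) \<le> a * real n \<and>
            real (L1 n (rgraph (E n) m2 \<omega>)) \<ge> b * real n \<and>
            real m2 \<le> real m1 + h n} \<le> bound n"
    using ev_h eventually_ge_at_top[of 1] ev_n[of "K J / b"] ev_n[of "2 * K J"] ev_n[of "2 / \<delta> J"]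
  proof eventually_elim
    case (elim n)
    have rule: "l_vertex_rule l n (M n) (F n) (v n) (E n)" by (rule assms(2)[OF elim(2)])
    interpret prob_space "M n" using rule unfolding l_vertex_rule_def by (rule conjunct1)
    interpret vertex_rule "M n" l n "F n" "v n" "E n"
      by unfold_locales (rule rule, rule elim(2))
    have q2: "\<delta> J * real n / 2 \<le> real (q n j)" if "j < J" for j
    proof -
      have "2 \<le> \<delta> J * real n" using elim(5) \<delta>[of J] by (simp add: field_simps)
      moreover have "\<delta> J * real n \<le> \<delta> j * real n" using \<delta>J[OF that] by (intro mult_right_mono) auto
      ultimately show ?thesis using qge[of j n] by linarith
    qed
    show ?case
      unfolding bound_def K_def q_def \<epsilon>_def c_def
    proof (rule prob_jump_le[OF l assms(3)[OF elim(2)] eta A(1) ab assms(5) True])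
      show "1 \<le> real J * (exp (- 2 * real A * \<eta>) * \<eta> / 2)" using J unfolding \<epsilon>_def c_def .
      show "real l * real (A ^ Suc J) * h n \<le> \<eta> * real n" using elim(1) unfolding K_def .
      show "real (A ^ Suc J) \<le> b * real n"
        using elim(3) b unfolding K_def[symmetric] by (simp add: field_simps)
      show "real (A ^ Suc J) \<le> real n / 2"
        using elim(4) unfolding K_def[symmetric] by simp
      fix j assume j: "j < J"
      have "1 \<le> \<delta> J * real n / 2" using elim(5) \<delta>[of J] by (simp add: field_simps)
      then have "1 \<le> q n j" using q2[OF j] by linarith
      then show "1 \<le> nat \<lfloor>\<eta> * real n / (2 * real l * real (A ^ Suc j))\<rfloor>" unfolding q_def .
      have "4 * real Q * real n \<le> real I * \<delta> J * real n"
        using I \<delta>[of J] by (intro mult_right_mono) (auto simp: field_simps)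
      also have "\<dots> \<le> 2 * (real I * real (q n j))"
        using mult_left_mono[OF q2[OF j], of "2 * real I"] by (simp add: mult_ac)
      finally have "real (2 * (Q * n)) \<le> real (I * q n j)" by simp
      then have "2 * (Q * n) \<le> I * q n j" by (simp only: of_nat_le_iff)
      then show "2 * (Q * n) \<le> I * nat \<lfloor>\<eta> * real n / (2 * real l * real (A ^ Suc j))\<rfloor>"
        unfolding q_def .
    qed
  qed
  then show ?thesis
    by (intro tendsto_sandwich[OF _ _ tendsto_const lim]) auto
qed

end
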